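(* Let $d, m \ge 1$ be integers, let $\varepsilon \ge 0$ be a real number, and let $v_1,\ldots,v_m$ be independent random vectors in $\mathbb{C}^d$ with finite support. Suppose that $\mathbb{E}\sum_{i=1}^{m} v_i v_i^{*} \leq I_d$ and that $\mathbb{E}\|v_i\|^2\leq \varepsilon$ for all $i \in \{1,\ldots,m\}$. Then $$\mathbb{P}\left[\,\Big\|\sum_{i=1}^{m} v_i v_i^{*}\Big\|\leq (1+\sqrt{\varepsilon})^2 \right]>0.$$
   Context: A random vector has finite support if it takes only finitely many values. For a column vector $v\in\mathbb{C}^d$, $v^{*}$ is its conjugate transpose, $vv^{*}$ is the corresponding $d\times d$ matrix of rank at most one, and $\|v\|$ is the Euclidean norm. For a matrix, $\|\cdot\|$ is the operator (spectral) norm. $I_d$ is the $d\times d$ identity matrix. For Hermitian matrices, $A\le B$ means that $B-A$ is positive semidefinite. *)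

theory Defs
  imports "HOL-Probability.Probability"
begin

definition adjoint_matrix :: "complex^'n^'m \<Rightarrow> complex^'m^'n" where
  "adjoint_matrix A = map_matrix cnj (transpose A)"

definition self_outer :: "complex^'n \<Rightarrow> complex^'n^'n" where
  "self_outer v = (\<chi> i j. v $ i * cnj (v $ j))"

definition hermitian :: "complex^'n^'n \<Rightarrow> bool" where
  "hermitian A \<longleftrightarrow> adjoint_matrix A = A"

text \<open>The quadratic form of a Hermitian matrix is real-valued, so taking its real part below
  loses nothing.\<close>

definition pos_semidef :: "complex^'n^'n \<Rightarrow> bool" where
  "pos_semidef A \<longleftrightarrow>
     hermitian A \<and> (\<forall>x. 0 \<le> Re (\<Sum>i\<in>UNIV. cnj (x $ i) * (A *v x) $ i))"

definition loewner_le :: "complex^'n^'n \<Rightarrow> complex^'n^'n \<Rightarrow> bool" where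
  "loewner_le A B \<longleftrightarrow> hermitian A \<and> hermitian B \<and> pos_semidef (B - A)"

text \<open>The norm on \<^typ>\<open>complex^'n\<close> is the Euclidean one, so this is the spectral norm
  (\<^typ>\<open>complex^'n^'n\<close> itself carries the Frobenius norm).\<close>

definition spectral_norm :: "complex^'n^'n \<Rightarrow> real" where
  "spectral_norm A = onorm (\<lambda>x. A *v x)"

end

(* The characteristic polynomials X |-> det (X - sum w_i w_i^* ) averaged over the random vectors belong
   to a class of "stable" functions on Hermitian matrices: real, nonvanishing on X + iZ with Z positive
   definite, and affine in rank-one directions. Affineness reduces D_u h / h for a rank-one direction u
   to a ratio b/a whose imaginary part has a fixed sign on the upper half plane. This yields its
   monotonicity, hence the interlacing step: some realisation of w has its largest root below that of
   the average. It also yields convexity, hence the barrier argument of Marcus, Spielman and Srivastava: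
   passing from h to E h(. - w w^* ) while moving the point by (1 + sqrt eps) E w w^* does not increase
   any barrier. Starting from det at a point above (sqrt eps + eps) I, the average over all vectors is
   positive above (1 + sqrt eps)^2 I. If eps = 0 this start degenerates; a perturbation of eps and the
   finiteness of the supports handle that case. *)
theory Submission
  imports Defs "HOL-Computational_Algebra.Fundamental_Theorem_Algebra"
begin

section \<open>Hermitian matrices\<close>

text \<open>The constant: at \<open>t I\<close> a vector with \<open>E |w|^2 <= eps\<close> has mean
  barrier at most \<open>eps / t\<close>. Averaging over it while shifting by \<open>delta\<close>
  times its second moment needs this to be at most \<open>1 - 1 / delta\<close>, and the walk ends
  at \<open>(t + delta) I\<close>. Minimising \<open>t + delta\<close> under
  \<open>eps / t = 1 - 1 / delta\<close> gives \<open>delta = 1 + sqrt eps\<close>,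
  \<open>t = sqrt eps + eps\<close> and the value \<open>(1 + sqrt eps)^2\<close>. Why convexity:
  \<open>h\<close> is affine along rank-one directions, so averaging is the first-order operator
  \<open>h - D_A h\<close>, with \<open>A\<close> the second moment. It corrects a barrier by a
  multiple of the derivative of that barrier along \<open>A\<close>; a tangent inequality pays for
  this with the shift. The largest root is tracked only as positivity on a ray
  \<open>x I - W\<close>, \<open>x >= R\<close>. If the average is positive there, the averaged
  function is too, but this has to be proved before a realisation can be chosen. Obstacle: stability
  controls positive definite directions only, while second moments may be singular. Monotonicity and
  convexity are therefore proved in directions \<open>Z + kappa I\<close> and passed to the
  limit.\<close>

definition cinner :: "complex^'n \<Rightarrow> complex^'n \<Rightarrow> complex" where
  "cinner x y = (\<Sum>i\<in>UNIV. cnj (x $ i) * y $ i)"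

definition cscale :: "complex \<Rightarrow> complex^'n^'m \<Rightarrow> complex^'n^'m" (infixr "*\<^sub>C" 75) where
  "c *\<^sub>C A = (\<chi> i j. c * A $ i $ j)"

definition pos_def :: "complex^'n^'n \<Rightarrow> bool" where
  "pos_def A \<longleftrightarrow> hermitian A \<and> (\<forall>x. x \<noteq> 0 \<longrightarrow> 0 < Re (cinner x (A *v x)))"

lemma pos_semidef_iff: "pos_semidef A \<longleftrightarrow> hermitian A \<and> (\<forall>x. 0 \<le> Re (cinner x (A *v x)))"
  by (simp add: pos_semidef_def cinner_def)

lemma cscale_nth [simp]: "(c *\<^sub>C A) $ i $ j = c * A $ i $ j"
  by (simp add: cscale_def)

lemma cscale_of_real: "of_real r *\<^sub>C A = r *\<^sub>R A"
  by (simp add: vec_eq_iff) (simp add: scaleR_conv_of_real)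

lemma cscale_0 [simp]: "0 *\<^sub>C A = 0"
  by (simp add: vec_eq_iff)

lemma cscale_zero_right [simp]: "c *\<^sub>C 0 = 0"
  by (simp add: vec_eq_iff)

lemma cscale_1 [simp]: "1 *\<^sub>C A = A"
  by (simp add: vec_eq_iff)

lemma cscale_add_left: "(a + b) *\<^sub>C A = a *\<^sub>C A + b *\<^sub>C A"
  by (simp add: vec_eq_iff algebra_simps)

lemma cscale_add_right: "a *\<^sub>C (A + B) = a *\<^sub>C A + a *\<^sub>C B"
  by (simp add: vec_eq_iff algebra_simps)

lemma cscale_cscale: "a *\<^sub>C b *\<^sub>C A = (a * b) *\<^sub>C A"
  by (simp add: vec_eq_iff algebra_simps)

lemma self_outer_nth [simp]: "self_outer v $ i $ j = v $ i * cnj (v $ j)"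
  by (simp add: self_outer_def)

lemma cinner_commute: "cnj (cinner x y) = cinner y x"
  by (simp add: cinner_def mult.commute)

lemma cinner_add_left: "cinner (x + y) z = cinner x z + cinner y z"
  by (simp add: cinner_def algebra_simps sum.distrib)

lemma cinner_add_right: "cinner x (y + z) = cinner x y + cinner x z"
  by (simp add: cinner_def algebra_simps sum.distrib)

lemma cinner_diff_right: "cinner x (y - z) = cinner x y - cinner x z"
  by (simp add: cinner_def algebra_simps sum_subtractf)

lemma cinner_scale_left: "cinner (c *s x) y = cnj c * cinner x y"
  by (simp add: cinner_def sum_distrib_left algebra_simps)

lemma cinner_scale_right: "cinner x (c *s y) = c * cinner x y"
  by (simp add: cinner_def sum_distrib_left algebra_simps)

lemma cinner_zero [simp]: "cinner x 0 = 0" "cinner 0 x = 0"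
  by (simp_all add: cinner_def)

lemma cinner_same: "cinner x x = of_real ((norm x)\<^sup>2)"
proof -
  have "cinner x x = (\<Sum>i\<in>UNIV. of_real ((norm (x $ i))\<^sup>2))"
    unfolding cinner_def by (intro sum.cong refl) (metis complex_norm_square mult.commute)
  also have "\<dots> = of_real ((norm x)\<^sup>2)"
    by (simp add: norm_vec_def L2_set_def sum_nonneg)
  finally show ?thesis .
qed

lemma cscale_mult_vec: "(c *\<^sub>C A) *v x = c *s (A *v x)"
  by (simp add: vec_eq_iff matrix_vector_mult_def sum_distrib_left mult.assoc)

lemma scaleR_mult_vec: "(r *\<^sub>R A) *v x = of_real r *s (A *v (x :: complex^'n))"
  by (metis cscale_of_real cscale_mult_vec)

lemma self_outer_mult_vec: "self_outer u *v x = cinner u x *s u"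
  by (simp add: vec_eq_iff matrix_vector_mult_def cinner_def sum_distrib_left mult.commute
      mult.left_commute)

lemma cinner_self_outer: "cinner x (self_outer u *v x) = of_real ((norm (cinner u x))\<^sup>2)"
  by (simp add: self_outer_mult_vec cinner_scale_right complex_norm_square cinner_commute del: of_real_power)

lemma hermitian_iff: "hermitian A \<longleftrightarrow> (\<forall>i j. cnj (A $ j $ i) = A $ i $ j)"
  by (simp add: hermitian_def adjoint_matrix_def vec_eq_iff transpose_def)

lemma hermitian_0 [simp, intro]: "hermitian 0"
  and hermitian_self_outer [simp, intro]: "hermitian (self_outer u)"
  and hermitian_mat [simp, intro]: "hermitian (mat (of_real r))"
  and hermitian_add [intro]: "hermitian A \<Longrightarrow> hermitian B \<Longrightarrow> hermitian (A + B)"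
  and hermitian_diff [intro]: "hermitian A \<Longrightarrow> hermitian B \<Longrightarrow> hermitian (A - B)"
  and hermitian_uminus [intro]: "hermitian A \<Longrightarrow> hermitian (- A)"
  and hermitian_scaleR [intro]: "hermitian A \<Longrightarrow> hermitian (r *\<^sub>R A)"
  by (auto simp: hermitian_iff mat_def)

lemma hermitian_mat_1 [simp, intro]: "hermitian (mat 1)"
  using hermitian_mat[of 1] by simp

lemma hermitian_cinner:
  assumes "hermitian A"
  shows "cinner (A *v x) y = cinner x (A *v y)"
proof -
  have "cinner (A *v x) y = (\<Sum>i\<in>UNIV. \<Sum>j\<in>UNIV. cnj (A $ i $ j) * cnj (x $ j) * y $ i)"
    by (simp add: cinner_def matrix_vector_mult_def sum_distrib_right)
  also have "\<dots> = (\<Sum>j\<in>UNIV. \<Sum>i\<in>UNIV. cnj (x $ j) * (A $ j $ i * y $ i))"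
    using assms by (subst sum.swap) (simp add: hermitian_iff algebra_simps)
  also have "\<dots> = cinner x (A *v y)"
    by (simp add: cinner_def matrix_vector_mult_def sum_distrib_left)
  finally show ?thesis .
qed

lemma hermitian_cinner_real:
  assumes "hermitian A"
  shows "of_real (Re (cinner x (A *v x))) = cinner x (A *v x)"
proof -
  have "cnj (cinner x (A *v x)) = cinner x (A *v x)"
    by (simp add: cinner_commute hermitian_cinner[OF assms])
  then show ?thesis
    by (metis Reals_cnj_iff of_real_Re)
qed

lemma pos_semidef_hermitian [dest]: "pos_semidef A \<Longrightarrow> hermitian A"
  by (simp add: pos_semidef_iff)

lemma pos_def_hermitian [dest]: "pos_def A \<Longrightarrow> hermitian A"
  by (simp add: pos_def_def)

lemma pos_def_imp_semidef: "pos_def A \<Longrightarrow> pos_semidef A"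
  unfolding pos_def_def pos_semidef_iff
  by (metis cinner_zero(2) less_imp_le order_refl zero_complex.simps(1))

lemma pos_semidef_0 [simp, intro]: "pos_semidef 0"
  by (simp add: pos_semidef_iff)

lemma pos_semidef_self_outer [simp, intro]: "pos_semidef (self_outer u)"
  by (simp add: pos_semidef_iff cinner_self_outer)

lemma pos_semidef_add [intro]: "pos_semidef A \<Longrightarrow> pos_semidef B \<Longrightarrow> pos_semidef (A + B)"
  by (auto simp: pos_semidef_iff matrix_vector_mult_add_rdistrib cinner_add_right)

lemma pos_def_add_semidef [intro]: "pos_def A \<Longrightarrow> pos_semidef B \<Longrightarrow> pos_def (A + B)"
  by (auto simp: pos_def_def pos_semidef_iff matrix_vector_mult_add_rdistrib cinner_add_right
      intro!: add_pos_nonneg)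

lemma pos_semidef_scaleR [intro]: "0 \<le> r \<Longrightarrow> pos_semidef A \<Longrightarrow> pos_semidef (r *\<^sub>R A)"
  by (auto simp: pos_semidef_iff scaleR_mult_vec cinner_scale_right)

lemma pos_def_scaleR [intro]: "0 < r \<Longrightarrow> pos_def A \<Longrightarrow> pos_def (r *\<^sub>R A)"
  by (auto simp: pos_def_def scaleR_mult_vec cinner_scale_right)

lemma pos_semidef_sum: "(\<And>i. i \<in> I \<Longrightarrow> pos_semidef (f i)) \<Longrightarrow> pos_semidef (sum f I)"
  by (induction I rule: infinite_finite_induct) auto

lemma mat_mult_vec: "mat c *v x = c *s (x :: complex^'n)"
  by (simp add: vec_eq_iff matrix_vector_mult_def mat_def mult_delta_left)

lemma pos_def_mat [intro]: "0 < r \<Longrightarrow> pos_def (mat (of_real r))"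
  by (simp add: pos_def_def mat_mult_vec cinner_scale_right cinner_same)

lemma pos_semidef_mat [intro]: "0 \<le> r \<Longrightarrow> pos_semidef (mat (of_real r))"
  by (simp add: pos_semidef_iff mat_mult_vec cinner_scale_right cinner_same)

text \<open>On the real line through \<open>x\<close> in direction \<open>y\<close> the form is a
  real quadratic in \<open>t\<close>; its discriminant is what gives Cauchy-Schwarz.\<close>

lemma cinner_add_mult_add:
  assumes "hermitian A"
  shows "Re (cinner (x + of_real t *s y) (A *v (x + of_real t *s y))) =
    Re (cinner x (A *v x)) + 2 * t * Re (cinner x (A *v y)) + t\<^sup>2 * Re (cinner y (A *v y))"
proof -
  have "cinner y (A *v x) = cnj (cinner x (A *v y))"
    by (simp add: cinner_commute hermitian_cinner[OF assms])
  then show ?thesis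
    by (simp add: matrix_vector_right_distrib cinner_add_left cinner_add_right
        vec.scale cinner_scale_left cinner_scale_right
        power2_eq_square algebra_simps)
qed

text \<open>Cauchy--Schwarz for the form of \<open>A\<close>, with \<open>y = A x\<close>.\<close>

lemma pos_semidef_cauchy_schwarz:
  assumes "pos_semidef A"
  shows "(norm (A *v x)) ^ 4 \<le>
    Re (cinner x (A *v x)) * Re (cinner (A *v x) (A *v (A *v x)))"
proof -
  define y where "y = A *v x"
  have herm: "hermitian A" using assms by auto
  define a b c where "a = Re (cinner x (A *v x))" and "b = Re (cinner x (A *v y))"
    and "c = Re (cinner y (A *v y))"
  have q: "0 \<le> a + 2 * t * b + t\<^sup>2 * c" for t
    using assms cinner_add_mult_add[OF herm, of x t y]
    unfolding pos_semidef_iff a_def b_def c_def by metis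
  have "a \<ge> 0" "c \<ge> 0"
    using assms by (auto simp: pos_semidef_iff a_def c_def)
  have "b\<^sup>2 \<le> a * c"
  proof (cases "c = 0")
    case True
    have "b = 0"
    proof (rule ccontr)
      assume "b \<noteq> 0"
      \<comment> \<open>With \<open>c = 0\<close> the quadratic is affine in \<open>t\<close>; this
        \<open>t\<close> gives it the value \<open>-1\<close>.\<close>
      with q[of "-(a + 1) / (2 * b)"] True show False
        by (simp add: field_simps)
    qed
    then show ?thesis using True by simp
  next
    case False
    with \<open>c \<ge> 0\<close> have "c > 0" by simp
    then show ?thesis
      using q[of "- b / c"] by (simp add: field_simps power2_eq_square)
  qed
  moreover have "b = (norm y)\<^sup>2"
  proof -
    have "cinner x (A *v y) = cinner y y"
      by (simp add: hermitian_cinner[OF herm, symmetric] y_def)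
    then show ?thesis by (simp add: b_def cinner_same del: of_real_power)
  qed
  ultimately show ?thesis
    by (simp add: a_def c_def y_def flip: power_mult)
qed

text \<open>The vanishing form is a factor of the Cauchy-Schwarz bound. This is what makes a
  maximiser of a quadratic form an eigenvector.\<close>

lemma pos_semidef_null:
  assumes "pos_semidef A" "Re (cinner x (A *v x)) = 0"
  shows "A *v x = 0"
  using pos_semidef_cauchy_schwarz[OF assms(1), of x] assms(2) 
  by (metis mult_zero_left norm_le_zero_iff power_eq_0_iff zero_le_even_power
      order_antisym even_numeral norm_eq_zero)

section \<open>Determinants: kernels, reality, stability and sign\<close>

lemma det_nonzero_if_ker_trivial:
  fixes A :: "complex^'n^'n"
  assumes "\<And>x. A *v x = 0 \<Longrightarrow> x = 0"
  shows "det A \<noteq> 0"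
proof -
  have "\<exists>B. B ** A = mat 1"
    using assms by (subst matrix_left_invertible_ker) auto
  then show ?thesis
    using invertible_left_inverse invertible_det_nz by blast
qed

lemma det_zero_if_ker:
  fixes A :: "complex^'n^'n"
  assumes "A *v x = 0" "x \<noteq> 0"
  shows "det A = 0"
proof (rule ccontr)
  assume "det A \<noteq> 0"
  then have "\<exists>B. B ** A = mat 1"
    using invertible_left_inverse invertible_det_nz by blast
  with assms show False
    by (subst (asm) matrix_left_invertible_ker) auto
qed

lemma det_cnj: "det (map_matrix cnj A) = cnj (det A)"
  by (simp add: det_def cnj_sum cnj_prod)

lemma det_hermitian_real: "hermitian A \<Longrightarrow> det A \<in> \<real>"
proof -
  assume "hermitian A"
  then have "det A = det (map_matrix cnj (transpose A))"
    by (simp add: hermitian_def adjoint_matrix_def)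
  also have "\<dots> = cnj (det A)"
    by (simp add: det_cnj)
  finally show ?thesis by (simp add: Reals_cnj_iff)
qed

text \<open>On a kernel vector \<open>x\<close> the forms of \<open>X\<close> and \<open>Z\<close>
  are the real and imaginary parts of 0, so the form of \<open>Z\<close> vanishes at
  \<open>x\<close>.\<close>

lemma det_stable:
  assumes "hermitian X" "pos_def Z"
  shows "det (X + \<i> *\<^sub>C Z) \<noteq> 0"
proof (rule det_nonzero_if_ker_trivial)
  fix x assume "(X + \<i> *\<^sub>C Z) *v x = 0"
  then have "cinner x (X *v x) + \<i> * cinner x (Z *v x) = 0"
    by (metis cinner_add_right cinner_scale_right cinner_zero(1) cscale_mult_vec
        matrix_vector_mult_add_rdistrib)
  then have "of_real (Re (cinner x (X *v x))) + \<i> * of_real (Re (cinner x (Z *v x))) = 0"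
    using assms by (simp add: hermitian_cinner_real pos_def_hermitian)
  then have "Re (cinner x (Z *v x)) = 0"
    by (simp add: complex_eq_iff)
  then show "x = 0"
    using assms(2) by (force simp: pos_def_def)
qed

lemma continuous_on_det [continuous_intros]:
  fixes f :: "'a :: topological_space \<Rightarrow> complex^'n^'n"
  assumes "continuous_on S f"
  shows "continuous_on S (\<lambda>x. det (f x))"
  unfolding det_def by (intro continuous_intros assms)

text \<open>The segment from the identity to \<open>A\<close> stays positive definite, so the real
  number \<open>det\<close> never vanishes along it and keeps the sign it has at the
  identity.\<close>

lemma det_pos_def:
  assumes "pos_def A"
  shows "0 < Re (det A)"
proof (rule ccontr)
  assume neg: "\<not> 0 < Re (det A)"
  define M where "M = (\<lambda>s::real. (1 - s) *\<^sub>R mat (of_real 1) + s *\<^sub>R A)"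
  have pd: "pos_def (M s)" if "s \<in> {0..1}" for s
  proof (cases "s = 1")
    case False
    have "pos_def ((1 - s) *\<^sub>R mat (of_real 1) + s *\<^sub>R A)"
      using that False assms
      by (intro pos_def_add_semidef pos_def_scaleR pos_def_mat pos_semidef_scaleR pos_def_imp_semidef) auto
    then show ?thesis by (simp add: M_def)
  qed (use assms in \<open>simp add: M_def\<close>)
  have "continuous_on {0..1} (\<lambda>s. Re (det (M s)))"
    unfolding M_def by (intro continuous_intros)
  then obtain s where s: "s \<in> {0..1}" "Re (det (M s)) = 0"
    using IVT2'[of "\<lambda>s. Re (det (M s))" 1 0 0] neg by (auto simp: M_def)
  have "det (M s) = 0"
    using det_hermitian_real[OF pos_def_hermitian[OF pd[OF s(1)]]] s(2)
    by (simp add: complex_eq_iff complex_is_Real_iff)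
  moreover have "det (M s) \<noteq> 0"
    using pd[OF s(1)] by (intro det_nonzero_if_ker_trivial)
      (metis cinner_zero(1) less_irrefl pos_def_def zero_complex.simps(1))
  ultimately show False by simp
qed

section \<open>Determinants along lines and under rank-one updates\<close>

abbreviation cpoly :: "real poly \<Rightarrow> complex poly" where
  "cpoly \<equiv> map_poly complex_of_real"

lemma poly_cpoly [simp]: "poly (cpoly p) (of_real x) = of_real (poly p x)"
  by (induction p) (auto simp: map_poly_pCons)

text \<open>Such a polynomial agrees with its conjugate at infinitely many points, so its
  coefficients are real.\<close>

lemma cpoly_Re:
  assumes "\<And>x::real. poly p (of_real x) \<in> \<real>"
  shows "cpoly (map_poly Re p) = p"
proof -
  have "poly (p - map_poly cnj p) (of_real x) = 0" for x
    using assms[of x] by (simp add: Reals_cnj_iff)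
  then have "range complex_of_real \<subseteq> {z. poly (p - map_poly cnj p) z = 0}"
    by auto
  moreover have "infinite (range complex_of_real)"
    by (simp add: finite_image_iff inj_def infinite_UNIV_char_0)
  ultimately have "p - map_poly cnj p = 0"
    using poly_roots_finite[of "p - map_poly cnj p"] finite_subset by blast
  then have "cnj (coeff p i) = coeff p i" for i
    by (metis coeff_map_poly complex_cnj_zero eq_iff_diff_eq_0)
  then show ?thesis
    by (simp add: poly_eq_iff coeff_map_poly complex_eq_iff)
qed

text \<open>Some \<open>b i\<close> may vanish and lower the degree, so the coefficient at
  \<open>card S\<close> is tracked instead of the leading one.\<close>

lemma coeff_prod_linear:
  fixes a b :: "'i \<Rightarrow> 'a :: comm_semiring_1"
  assumes "finite S"
  shows "degree (\<Prod>i\<in>S. [:a i, b i:]) \<le> card S \<and> coeff (\<Prod>i\<in>S. [:a i, b i:]) (card S) = (\<Prod>i\<in>S. b i)"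
  using assms
proof (induction S)
  case (insert x S)
  let ?q = "\<Prod>i\<in>S. [:a i, b i:]"
  have "coeff ?q (Suc (card S)) = 0"
    using insert.IH by (intro coeff_eq_0) simp
  moreover have "degree ([:a x, b x:] * ?q) \<le> Suc (card S)"
    using degree_mult_le[of "[:a x, b x:]" ?q] insert.IH
    by (simp add: degree_pCons_eq_if split: if_splits)
  ultimately show ?case
    using insert by (simp add: coeff_pCons)
qed simp

text \<open>Leibniz expansion with linear polynomials as entries. The coefficient at
  \<open>CARD('n)\<close> is recorded because \<open>det Z \<noteq> 0\<close> then gives the
  polynomial full degree, which the convexity proof needs.\<close>

lemma det_line_poly:
  fixes X Z :: "complex^'n^'n"
  assumes "hermitian X" "hermitian Z"
  obtains p where "degree p \<le> CARD('n)" "coeff p CARD('n) = Re (det Z)"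
    "\<And>s. det (X + s *\<^sub>C Z) = poly (cpoly p) s"
proof -
  define P where "P = det (\<chi> i j. [:X $ i $ j, Z $ i $ j:] :: complex poly^'n^'n)"
  have P: "P = (\<Sum>f\<in>{f. f permutes UNIV}. of_int (sign f) *
      (\<Prod>i\<in>UNIV. [:X $ i $ f i, Z $ i $ f i:]))"
    by (simp add: P_def det_def)
  have val: "poly P s = det (X + s *\<^sub>C Z)" for s
    by (simp add: P det_def poly_sum poly_prod algebra_simps)
  have prod: "degree (\<Prod>i\<in>UNIV. [:X $ i $ f i, Z $ i $ f i:]) \<le> CARD('n)"
    "coeff (\<Prod>i\<in>UNIV. [:X $ i $ f i, Z $ i $ f i:]) CARD('n) = (\<Prod>i\<in>UNIV. Z $ i $ f i)" for f
    using coeff_prod_linear[of "UNIV :: 'n set" "\<lambda>i. X $ i $ f i" "\<lambda>i. Z $ i $ f i"] by auto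
  have deg: "degree P \<le> CARD('n)"
    unfolding P
  proof (intro degree_sum_le)
    fix f :: "'n \<Rightarrow> 'n"
    show "degree (of_int (sign f) * (\<Prod>i\<in>UNIV. [:X $ i $ f i, Z $ i $ f i:])) \<le> CARD('n)"
      using degree_mult_le[of "of_int (sign f)" "\<Prod>i\<in>UNIV. [:X $ i $ f i, Z $ i $ f i:]"] prod(1)[of f]
      by simp
  qed (simp add: finite_permutations)
  have coeff: "coeff P CARD('n) = det Z"
    by (simp add: P det_def coeff_sum of_int_poly prod(2))
  have "poly P (of_real x) \<in> \<real>" for x
    using assms unfolding val cscale_of_real by (intro det_hermitian_real) auto
  then have "cpoly (map_poly Re P) = P"
    by (rule cpoly_Re)
  moreover have "degree (map_poly Re P) \<le> CARD('n)"
    using map_poly_degree_leq[of Re P] deg by linarith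
  moreover have "coeff (map_poly Re P) CARD('n) = Re (det Z)"
    by (simp add: coeff_map_poly coeff)
  ultimately show ?thesis
    using that[of "map_poly Re P"] by (simp add: val)
qed

lemma matrix_mult_cscale:
  "A ** (c *\<^sub>C B) = c *\<^sub>C (A ** B)" "(c *\<^sub>C A) ** B = c *\<^sub>C (A ** B)"
  by (simp_all add: vec_eq_iff matrix_matrix_mult_def sum_distrib_left algebra_simps)

lemma matrix_mult_add_right: "(A + B) ** C = A ** C + B ** (C :: complex^'n^'n)"
  by (simp add: vec_eq_iff matrix_matrix_mult_def sum.distrib algebra_simps)

text \<open>A congruence turns \<open>u u\<^sup>*\<close> into a matrix unit, and the determinant is linear in each row.\<close>

lemma det_rank_one:
  fixes X :: "complex^'n^'n"
  shows "det (X + t *\<^sub>C self_outer u) = det X + t * (det (X + self_outer u) - det X)"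
proof (cases "u = 0")
  case True
  then have "self_outer u = 0" by (simp add: vec_eq_iff)
  then show ?thesis by simp
next
  case False
  then obtain k where k: "u $ k \<noteq> 0" by (auto simp: vec_eq_iff)
  \<comment> \<open>The identity with column \<open>k\<close> replaced by \<open>u\<close>: its
    determinant is \<open>u $ k\<close> by Cramer's rule, hence nonzero.\<close>
  define Q :: "complex^'n^'n" where "Q = (\<chi> i j. if j = k then u $ i else if i = j then 1 else 0)"
  define Qa where "Qa = adjoint_matrix Q"
  define E :: "complex^'n^'n" where "E = (\<chi> i j. if i = k \<and> j = k then 1 else 0)"
  have "Q = (\<chi> i j. if j = k then (mat 1 *v u) $ i else mat 1 $ i $ j)"
    by (simp add: Q_def vec_eq_iff) (simp add: mat_def)
  then have dQ: "det Q \<noteq> 0"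
    using cramer_lemma[where A = "mat 1" and x = u and k = k] k by simp
  then have dQa: "det Qa \<noteq> 0"
    by (simp add: Qa_def adjoint_matrix_def det_cnj)
  obtain P where P: "Q ** P = mat 1"
    using dQ invertible_det_nz invertible_right_inverse by blast
  obtain R where R: "R ** Qa = mat 1"
    using dQa invertible_det_nz invertible_left_inverse by blast
  define Y where "Y = P ** X ** R"
  have X: "X = Q ** Y ** Qa"
    by (metis P R Y_def matrix_mul_assoc matrix_mul_lid matrix_mul_rid)
  have "(\<Sum>l\<in>UNIV. Q $ i $ l * E $ l $ j) = (if j = k then u $ i else 0)" for i j
  proof -
    have "(\<Sum>l\<in>UNIV. Q $ i $ l * E $ l $ j) = (\<Sum>l\<in>UNIV. if l = k then Q $ i $ k * E $ k $ j else 0)"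
      by (intro sum.cong) (auto simp: E_def)
    then show ?thesis by (simp add: Q_def E_def)
  qed
  then have "Q ** E = (\<chi> i j. if j = k then u $ i else 0)"
    by (simp add: vec_eq_iff matrix_matrix_mult_def)
  moreover have "Qa $ k $ j = cnj (u $ j)" for j
    by (simp add: Qa_def adjoint_matrix_def transpose_def Q_def)
  moreover have "(\<Sum>l\<in>UNIV. (if l = k then c else 0) * Qa $ l $ j) = c * Qa $ k $ j" for c j
  proof -
    have "(\<Sum>l\<in>UNIV. (if l = k then c else 0) * Qa $ l $ j) =
        (\<Sum>l\<in>UNIV. if l = k then c * Qa $ k $ j else 0)"
      by (intro sum.cong) auto
    then show ?thesis by simp
  qed
  ultimately have QEQ: "Q ** E ** Qa = self_outer u"
    by (simp add: vec_eq_iff matrix_matrix_mult_def)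
  have XQ: "X + s *\<^sub>C self_outer u = Q ** (Y + s *\<^sub>C E) ** Qa" for s
    unfolding QEQ[symmetric]
    by (subst X) (simp add: matrix_add_ldistrib matrix_mult_add_right matrix_mult_cscale matrix_mul_assoc)
  define D where "D = det ((\<chi> i. if i = k then axis k 1 else Y $ i) :: complex^'n^'n)"
  have "det (Y + s *\<^sub>C E) = det Y + s * D" for s
  proof -
    have "Y + s *\<^sub>C E = (\<chi> i. if i = k then Y $ i + s *s axis k 1 else Y $ i)"
      by (simp add: vec_eq_iff E_def axis_def)
    moreover have "(\<chi> i. if i = k then Y $ i else Y $ i) = Y"
      by (simp add: vec_eq_iff)
    ultimately show ?thesis
      by (simp add: det_row_add[of k "\<lambda>i. Y $ i" "\<lambda>i. s *s axis k 1" "\<lambda>i. Y $ i"]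
          det_row_mul[of k s "\<lambda>i. axis k 1" "\<lambda>i. Y $ i"] D_def)
  qed
  then have dd: "det (X + s *\<^sub>C self_outer u) = det Q * det Qa * (det Y + s * D)" for s
    by (simp add: XQ det_mul algebra_simps)
  show ?thesis
    using dd[of t] dd[of 1] dd[of 0] by (simp add: algebra_simps)
qed

text \<open>Only the slope in \<open>t\<close> is unknown. It is read off at
  \<open>t = -1 / |u|^2\<close>, where \<open>u\<close> lies in the kernel and the determinant is
  0.\<close>

lemma det_mat_1_rank_one:
  "det (mat 1 + t *\<^sub>C self_outer u) = 1 + t * of_real ((norm u)\<^sup>2)"
proof (cases "u = 0")
  case True
  then have "self_outer u = 0" by (simp add: vec_eq_iff)
  then show ?thesis using True by simp
next
  case False
  define c where "c = det (mat 1 + self_outer u) - 1"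
  define N where "N = complex_of_real ((norm u)\<^sup>2)"
  have "N \<noteq> 0" using False by (simp add: N_def)
  have "(mat 1 + (- 1 / N) *\<^sub>C self_outer u) *v u = 0"
    using \<open>N \<noteq> 0\<close> by (simp add: matrix_vector_mult_add_rdistrib cscale_mult_vec self_outer_mult_vec
        cinner_same vec_eq_iff N_def[symmetric] del: of_real_power)
  then have "det (mat 1 + (- 1 / N) *\<^sub>C self_outer u) = 0"
    using False by (rule det_zero_if_ker)
  then have "c = N"
    using det_rank_one[of "mat 1" "- 1 / N" u] \<open>N \<noteq> 0\<close> by (simp add: c_def field_simps)
  then show ?thesis
    using det_rank_one[of "mat 1" t u] by (simp add: c_def N_def algebra_simps)
qed

section \<open>Stable forms\<close>

lemma poly_pderiv_cpoly [simp]: "poly (pderiv (cpoly p)) (of_real x) = of_real (poly (pderiv p) x)"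
proof -
  have "pderiv (cpoly p) = cpoly (pderiv p)"
    by (simp add: poly_eq_iff coeff_pderiv coeff_map_poly)
  then show ?thesis by simp
qed

lemma Re_cinner_eq_inner: "Re (cinner x y) = x \<bullet> y"
  by (simp add: cinner_def inner_vec_def inner_complex_def)

lemma hermitian_add_mat_pos_def:
  assumes "hermitian (A :: complex^'n^'n)"
  obtains c where "\<And>x. x \<ge> c \<Longrightarrow> pos_def (A + mat (of_real x))"
proof -
  obtain K where K: "\<And>x. norm (A *v x) \<le> norm x * K"
    using bounded_linear.bounded[OF matrix_vector_mul_bounded_linear[of A]] by blast
  have "pos_def (A + mat (of_real c))" if c: "c \<ge> K + 1" for c
    unfolding pos_def_def
  proof (intro conjI allI impI)
    fix x :: "complex^'n" assume "x \<noteq> 0"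
    have "\<bar>x \<bullet> (A *v x)\<bar> \<le> norm x * norm (A *v x)"
      by (rule Cauchy_Schwarz_ineq2)
    also have "\<dots> \<le> norm x * (norm x * K)"
      by (intro mult_left_mono K) simp
    also have "\<dots> \<le> (c - 1) * (norm x)\<^sup>2"
      using mult_right_mono[of K "c - 1" "(norm x)\<^sup>2"] c by (simp add: power2_eq_square mult_ac)
    finally have "- Re (cinner x (A *v x)) \<le> (c - 1) * (norm x)\<^sup>2"
      by (simp add: Re_cinner_eq_inner abs_le_iff)
    moreover have "(norm x)\<^sup>2 > 0" using \<open>x \<noteq> 0\<close> by simp
    ultimately have "0 < Re (cinner x (A *v x)) + c * (norm x)\<^sup>2"
      unfolding left_diff_distrib by linarith
    then show "0 < Re (cinner x ((A + mat (of_real c)) *v x))"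
      by (simp add: matrix_vector_mult_add_rdistrib cinner_add_right mat_mult_vec
          cinner_scale_right cinner_same)
  qed (use assms in auto)
  then show ?thesis using that by blast
qed

text \<open>For \<open>b \<noteq> 0\<close> the root \<open>- a / b\<close> of
  \<open>a + t * b\<close> lies in the open lower half plane, and inversion reverses the sign of the
  imaginary part. The equality case is what excludes zeros of an average in
  \<open>nonzero_mix\<close>.\<close>

lemma Im_ratio_nonpos:
  fixes a b :: complex
  assumes "\<And>t. Im t \<ge> 0 \<Longrightarrow> a + t * b \<noteq> 0"
  shows "Im (b / a) \<le> 0" "Im (b / a) = 0 \<Longrightarrow> b = 0"
proof -
  have "Im (b / a) < 0" if "b \<noteq> 0"
  proof -
    have "a \<noteq> 0" using assms[of 0] by simp
    have "a + (- a / b) * b = 0" using that by simp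
    then have "Im (- a / b) < 0" using assms[of "- a / b"] by force
    then have "Im (a / b) > 0" by simp
    moreover have "b / a = inverse (a / b)" by simp
    moreover have "Im (inverse (a / b)) = - Im (a / b) / ((Re (a / b))\<^sup>2 + (Im (a / b))\<^sup>2)"
      by (rule inverse_complex.sel(2))
    ultimately show ?thesis
      by (metis add_nonneg_pos divide_neg_pos less_irrefl neg_less_0_iff_less zero_le_power2 zero_less_power2)
  qed
  then show "Im (b / a) \<le> 0" "Im (b / a) = 0 \<Longrightarrow> b = 0"
    by fastforce+
qed

text \<open>The derivative is taken vertically. As \<open>b / a\<close> is real at \<open>x\<close>,
  the real part of the difference quotient with step \<open>\<i> * \<eta>\<close> is the imaginary
  part of \<open>b / a\<close> above \<open>x\<close>, divided by \<open>\<eta>\<close>.\<close>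

lemma ratio_deriv_nonpos:
  fixes a b :: "real poly"
  assumes "poly a x \<noteq> 0"
    and "\<And>\<eta>. \<eta> > 0 \<Longrightarrow> Im (poly (cpoly b) (Complex x \<eta>) / poly (cpoly a) (Complex x \<eta>)) \<le> 0"
  shows "(poly (pderiv b) x * poly a x - poly b x * poly (pderiv a) x) / (poly a x * poly a x) \<le> 0"
    (is "?D \<le> 0")
proof -
  define F where "F = (\<lambda>s. poly (cpoly b) s / poly (cpoly a) s)"
  have "(F has_field_derivative of_real ?D) (at (of_real x))"
    unfolding F_def using assms(1) by (auto intro!: derivative_eq_intros)
  then have "((\<lambda>s. (F (of_real x + s) - F (of_real x)) / s) \<longlongrightarrow> of_real ?D) (at 0)"
    by (simp add: DERIV_def)
  moreover have "filterlim (\<lambda>\<eta>. \<i> * of_real \<eta>) (at 0) (at_right 0)"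
    by (auto simp: filterlim_at eventually_at_filter intro!: tendsto_eq_intros)
  ultimately have "((\<lambda>\<eta>. (F (of_real x + \<i> * of_real \<eta>) - F (of_real x)) / (\<i> * of_real \<eta>)) \<longlongrightarrow>
      of_real ?D) (at_right 0)"
    by (rule filterlim_compose)
  then have "((\<lambda>\<eta>. Re ((F (of_real x + \<i> * of_real \<eta>) - F (of_real x)) / (\<i> * of_real \<eta>))) \<longlongrightarrow>
      Re (of_real ?D)) (at_right 0)"
    by (rule tendsto_Re)
  moreover have "Re ((F (of_real x + \<i> * of_real \<eta>) - F (of_real x)) / (\<i> * of_real \<eta>)) \<le> 0"
    if "\<eta> > 0" for \<eta>
  proof -
    have "F (of_real x) = of_real (poly b x / poly a x)"
      by (simp add: F_def)
    then have "Im (F (of_real x)) = 0" by simp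
    moreover have "of_real x + \<i> * of_real \<eta> = Complex x \<eta>" by (simp add: complex_eq_iff)
    moreover have "Re (z / (\<i> * of_real \<eta>)) = Im z / \<eta>" for z
      using that by (simp add: Re_divide power2_eq_square)
    ultimately show ?thesis
      using assms(2)[OF that] that by (simp add: F_def divide_nonpos_pos)
  qed
  then have "\<forall>\<^sub>F \<eta> in at_right 0. Re ((F (of_real x + \<i> * of_real \<eta>) - F (of_real x)) / (\<i> * of_real \<eta>)) \<le> 0"
    by (auto simp: eventually_at_filter)
  ultimately have "Re (of_real ?D) \<le> 0"
    by (rule tendsto_upperbound) simp
  then show ?thesis by simp
qed

text \<open>The functions obtained from \<open>det\<close> by averaging over rank-one translations.\<close>

locale stable_form =
  fixes h :: "complex^'n^'n \<Rightarrow> complex"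
  assumes line: "hermitian X \<Longrightarrow> hermitian Z \<Longrightarrow>
      \<exists>p. degree p \<le> CARD('n) \<and> coeff p CARD('n) = Re (det Z) \<and>
        (\<forall>s. h (X + s *\<^sub>C Z) = poly (cpoly p) s)"
    and diff: "h differentiable (at X)"
    and rank_one: "h (X + t *\<^sub>C self_outer u) = h X + t * (h (X + self_outer u) - h X)"
    and nonzero: "hermitian X \<Longrightarrow> pos_def Z \<Longrightarrow> h (X + \<i> *\<^sub>C Z) \<noteq> 0"
    and eventually_pos: "hermitian X \<Longrightarrow>
      \<exists>c. \<forall>x\<ge>c. \<forall>Z. pos_semidef Z \<longrightarrow> 0 < Re (h (X + mat (of_real x) + Z))"

lemma differentiable_prod:
  fixes f :: "'i \<Rightarrow> 'a :: real_normed_vector \<Rightarrow> 'b :: real_normed_field"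
  assumes "\<And>i. i \<in> I \<Longrightarrow> f i differentiable (at x)"
  shows "(\<lambda>x. \<Prod>i\<in>I. f i x) differentiable (at x)"
  using assms by (induction I rule: infinite_finite_induct) auto

lemma det_differentiable: "(det :: complex^'n^'n \<Rightarrow> complex) differentiable (at X)"
proof -
  have "(\<lambda>A :: complex^'n^'n. A $ i $ j) differentiable (at X)" for i j
    using bounded_linear_compose[OF bounded_linear_vec_nth[of j] bounded_linear_vec_nth[of i]]
    by (rule bounded_linear_imp_differentiable)
  then have "(\<lambda>A :: complex^'n^'n. \<Sum>f\<in>{f. f permutes UNIV}. of_int (sign f) * (\<Prod>i\<in>UNIV. A $ i $ f i))
      differentiable (at X)"
    by (intro differentiable_sum differentiable_mult differentiable_prod differentiable_const
        finite_permutations ballI) auto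
  then show ?thesis by (simp add: det_def[abs_def])
qed

lemma stable_form_det: "stable_form (det :: complex^'n^'n \<Rightarrow> complex)"
proof
  fix X Z :: "complex^'n^'n" assume "hermitian X" "hermitian Z"
  then obtain p where "degree p \<le> CARD('n)" "coeff p CARD('n) = Re (det Z)"
    "\<And>s. det (X + s *\<^sub>C Z) = poly (cpoly p) s"
    by (rule det_line_poly) blast
  then show "\<exists>p. degree p \<le> CARD('n) \<and> coeff p CARD('n) = Re (det Z) \<and>
      (\<forall>s. det (X + s *\<^sub>C Z) = poly (cpoly p) s)"
    by blast
next
  fix X :: "complex^'n^'n" assume "hermitian X"
  then obtain c where "\<And>x. x \<ge> c \<Longrightarrow> pos_def (X + mat (of_real x))"
    using hermitian_add_mat_pos_def by blast
  then show "\<exists>c. \<forall>x\<ge>c. \<forall>Z. pos_semidef Z \<longrightarrow> 0 < Re (det (X + mat (of_real x) + Z))"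
    by (blast intro: det_pos_def pos_def_add_semidef)
qed (use det_differentiable det_rank_one det_stable in blast)+

text \<open>\<open>mix S p h\<close> is \<open>X \<mapsto> E h(X - w w\<^sup>*)\<close> for a random \<open>w\<close> with distribution \<open>p\<close> on \<open>S\<close>.\<close>

definition mix :: "(complex^'n) set \<Rightarrow> (complex^'n \<Rightarrow> real) \<Rightarrow> (complex^'n^'n \<Rightarrow> complex) \<Rightarrow>
    complex^'n^'n \<Rightarrow> complex" where
  "mix S p h X = (\<Sum>w\<in>S. of_real (p w) * h (X - self_outer w))"

lemma cscale_minus_1: "(- 1) *\<^sub>C A = - A"
  by (simp add: vec_eq_iff)

context stable_form
begin

lemma rank_one_minus: "h (X - self_outer w) = h X - (h (X + self_outer w) - h X)"
  using rank_one[of X "- 1" w] by (simp add: cscale_minus_1)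

text \<open>The point \<open>X + s Z + t u u^*\<close> is Hermitian plus \<open>\<i>\<close> times
  positive definite. The form affine in \<open>t\<close> is the hypothesis of
  \<open>Im_ratio_nonpos\<close>.\<close>

lemma nonzero_rank_one:
  assumes "hermitian X" "pos_def Z" "Im s > 0" "Im t \<ge> 0"
  shows "h (X + s *\<^sub>C Z) + t * (h (X + s *\<^sub>C Z + self_outer u) - h (X + s *\<^sub>C Z)) \<noteq> 0"
proof -
  have "X + s *\<^sub>C Z + t *\<^sub>C self_outer u =
      (X + Re s *\<^sub>R Z + Re t *\<^sub>R self_outer u) + \<i> *\<^sub>C (Im s *\<^sub>R Z + Im t *\<^sub>R self_outer u)"
    by (subst complex_eq[of s], subst complex_eq[of t])
      (simp only: cscale_add_left cscale_add_right cscale_of_real cscale_cscale[symmetric] ac_simps)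
  moreover have "hermitian (X + Re s *\<^sub>R Z + Re t *\<^sub>R self_outer u)"
    using assms by (intro hermitian_add hermitian_scaleR) auto
  moreover have "pos_def (Im s *\<^sub>R Z + Im t *\<^sub>R self_outer u)"
    using assms by (intro pos_def_add_semidef pos_def_scaleR pos_semidef_scaleR) auto
  ultimately have "h (X + s *\<^sub>C Z + t *\<^sub>C self_outer u) \<noteq> 0"
    by (simp only: nonzero not_False_eq_True)
  then show ?thesis by (simp add: rank_one)
qed

text \<open>The average is \<open>a * (1 - r)\<close>, where \<open>r\<close> is the mean of the
  ratios \<open>b w / a\<close>. At a zero \<open>r = 1\<close> is real, but all these ratios have
  imaginary part at most 0; so each is real, each \<open>b w\<close> is 0, and
  \<open>r = 0\<close>.\<close>

lemma nonzero_mix: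
  assumes "finite S" "\<And>w. w \<in> S \<Longrightarrow> p w > 0" "sum p S = 1" "hermitian X" "pos_def Z"
  shows "mix S p h (X + \<i> *\<^sub>C Z) \<noteq> 0"
proof
  define a where "a = h (X + \<i> *\<^sub>C Z)"
  define b where "b w = h (X + \<i> *\<^sub>C Z + self_outer w) - a" for w
  have "a \<noteq> 0" using nonzero assms unfolding a_def by blast
  have nz: "a + t * b w \<noteq> 0" if "Im t \<ge> 0" for t w
    using nonzero_rank_one[OF assms(4,5), of \<i> t] that by (simp add: a_def b_def)
  have le: "Im (b w / a) \<le> 0" for w
    by (rule Im_ratio_nonpos) (rule nz)
  have eq0: "b w = 0" if "Im (b w / a) = 0" for w
    using Im_ratio_nonpos(2)[of a "b w"] nz that by blast
  assume "mix S p h (X + \<i> *\<^sub>C Z) = 0"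
  then have "(\<Sum>w\<in>S. of_real (p w) * (a - b w)) = 0"
    by (simp add: mix_def rank_one_minus a_def b_def)
  moreover have "(\<Sum>w\<in>S. of_real (p w) * (a - b w)) = a * (1 - (\<Sum>w\<in>S. of_real (p w) * (b w / a)))"
  proof -
    have "a = (\<Sum>w\<in>S. of_real (p w) * a)"
      using assms(3) by (metis mult_1 of_real_1 of_real_sum sum_distrib_right)
    moreover have "a * (\<Sum>w\<in>S. of_real (p w) * (b w / a)) = (\<Sum>w\<in>S. of_real (p w) * b w)"
      using \<open>a \<noteq> 0\<close> by (simp add: sum_distrib_left)
    ultimately show ?thesis
      by (simp add: right_diff_distrib sum_subtractf)
  qed
  ultimately have one: "(\<Sum>w\<in>S. of_real (p w) * (b w / a)) = 1"
    using \<open>a \<noteq> 0\<close> by simp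
  then have "Im (\<Sum>w\<in>S. of_real (p w) * (b w / a)) = 0"
    by simp
  then have "(\<Sum>w\<in>S. p w * (- Im (b w / a))) = 0"
    by (simp add: Im_sum sum_negf del: Im_divide times_divide_eq_right)
  moreover have "p w * (- Im (b w / a)) \<ge> 0" if "w \<in> S" for w
    using le[of w] assms(2)[OF that] by (intro mult_nonneg_nonneg) auto
  ultimately have "p w * (- Im (b w / a)) = 0" if "w \<in> S" for w
    using sum_nonneg_eq_0_iff[OF assms(1), of "\<lambda>w. p w * (- Im (b w / a))"] that by simp
  then have "b w = 0" if "w \<in> S" for w
    using eq0 assms(2) that by (metis less_irrefl mult_eq_0_iff neg_equal_0_iff_equal)
  then show False using one by simp
qed

lemma stable_form_mix:
  assumes "finite S" "\<And>w. w \<in> S \<Longrightarrow> p w > 0" "sum p S = 1"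
  shows "stable_form (mix S p h)"
proof
  fix X Z :: "complex^'n^'n" assume XZ: "hermitian X" "hermitian Z"
  have "\<exists>q. degree q \<le> CARD('n) \<and> coeff q CARD('n) = Re (det Z) \<and>
        (\<forall>s. h (X - self_outer w + s *\<^sub>C Z) = poly (cpoly q) s)" for w
    using XZ by (intro line) auto
  then obtain q where q: "\<And>w. degree (q w) \<le> CARD('n)" "\<And>w. coeff (q w) CARD('n) = Re (det Z)"
    "\<And>w s. h (X - self_outer w + s *\<^sub>C Z) = poly (cpoly (q w)) s"
    by metis
  define r where "r = (\<Sum>w\<in>S. smult (p w) (q w))"
  have "degree r \<le> CARD('n)"
    unfolding r_def using q(1) assms(1) by (intro degree_sum_le) (auto intro: order_trans[OF degree_smult_le])
  moreover have "coeff r CARD('n) = Re (det Z)"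
    using assms(3) by (simp add: r_def coeff_sum q(2) flip: sum_distrib_right)
  moreover have "cpoly r = (\<Sum>w\<in>S. smult (of_real (p w)) (cpoly (q w)))"
    by (simp add: r_def poly_eq_iff coeff_map_poly coeff_sum)
  then have "mix S p h (X + s *\<^sub>C Z) = poly (cpoly r) s" for s
    by (simp add: mix_def poly_sum q(3)[symmetric] algebra_simps)
  ultimately show "\<exists>r. degree r \<le> CARD('n) \<and> coeff r CARD('n) = Re (det Z) \<and>
        (\<forall>s. mix S p h (X + s *\<^sub>C Z) = poly (cpoly r) s)"
    by blast
next
  fix X
  have "(\<lambda>X. h (X - self_outer w)) differentiable (at X)" for w
    using differentiable_chain_at[of "\<lambda>X. X - self_outer w" X h] diff
    by (simp add: o_def)
  then have "(\<lambda>X. \<Sum>w\<in>S. of_real (p w) * h (X - self_outer w)) differentiable (at X)"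
    using assms(1) by (intro differentiable_sum differentiable_mult) auto
  then show "mix S p h differentiable (at X)"
    by (simp add: mix_def[abs_def])
next
  fix X t u
  have "h (X + t *\<^sub>C self_outer u - self_outer w) = h (X - self_outer w) +
      t * (h (X + self_outer u - self_outer w) - h (X - self_outer w))" for w
    using rank_one[of "X - self_outer w" t u] by (simp add: algebra_simps)
  then have "mix S p h (X + t *\<^sub>C self_outer u) = (\<Sum>w\<in>S. of_real (p w) * (h (X - self_outer w) +
      t * (h (X + self_outer u - self_outer w) - h (X - self_outer w))))"
    by (simp only: mix_def)
  then show "mix S p h (X + t *\<^sub>C self_outer u) =
      mix S p h X + t * (mix S p h (X + self_outer u) - mix S p h X)"
    by (simp add: mix_def sum.distrib sum_subtractf sum_distrib_left algebra_simps)
next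
  fix X Z :: "complex^'n^'n" assume "hermitian X" "pos_def Z"
  then show "mix S p h (X + \<i> *\<^sub>C Z) \<noteq> 0"
    using nonzero_mix assms by blast
next
  fix X :: "complex^'n^'n" assume X: "hermitian X"
  have "\<exists>c. \<forall>x\<ge>c. \<forall>Z. pos_semidef Z \<longrightarrow> 0 < Re (h (X - self_outer w + mat (of_real x) + Z))" for w
    using X by (intro eventually_pos) auto
  then obtain c where c: "\<And>w x Z. x \<ge> c w \<Longrightarrow> pos_semidef Z \<Longrightarrow>
      0 < Re (h (X - self_outer w + mat (of_real x) + Z))"
    by metis
  have "S \<noteq> {}" using assms(3) by auto
  have "0 < Re (mix S p h (X + mat (of_real x) + Z))"
    if "x \<ge> Max (c ` S)" "pos_semidef Z" for x Z
  proof -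
    have "0 < p w * Re (h (X + mat (of_real x) + Z - self_outer w))" if "w \<in> S" for w
    proof (intro mult_pos_pos)
      have "c w \<le> Max (c ` S)" using that assms(1) by simp
      then show "0 < Re (h (X + mat (of_real x) + Z - self_outer w))"
        using c[of w x Z] \<open>x \<ge> Max (c ` S)\<close> \<open>pos_semidef Z\<close> by (simp add: algebra_simps)
    qed (use that assms(2) in auto)
    then show ?thesis
      using \<open>S \<noteq> {}\<close> assms(1) by (simp add: mix_def Re_sum sum_pos)
  qed
  then show "\<exists>c. \<forall>x\<ge>c. \<forall>Z. pos_semidef Z \<longrightarrow> 0 < Re (mix S p h (X + mat (of_real x) + Z))"
    by blast
qed

end

section \<open>Barrier functions and the interlacing argument\<close>

text \<open>\<open>barrier h u X\<close> is \<open>D\<^sub>Z h(X) / h(X)\<close> for \<open>Z = u u\<^sup>*\<close>, since \<open>h\<close> is affine in rank-one directions.\<close>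

definition barrier :: "(complex^'n^'n \<Rightarrow> complex) \<Rightarrow> complex^'n \<Rightarrow> complex^'n^'n \<Rightarrow> real" where
  "barrier h u X = Re (h (X + self_outer u)) / Re (h X) - 1"

text \<open>The matrix version of a point above the roots of a multivariate polynomial, with the
  semidefinite cone in place of the positive orthant.\<close>

definition above_roots :: "(complex^'n^'n \<Rightarrow> complex) \<Rightarrow> complex^'n^'n \<Rightarrow> bool" where
  "above_roots h X \<longleftrightarrow> hermitian X \<and> (\<forall>Z. pos_semidef Z \<longrightarrow> 0 < Re (h (X + Z)))"

lemma above_roots_pos: "above_roots h X \<Longrightarrow> 0 < Re (h X)"
  by (metis above_roots_def add.right_neutral pos_semidef_0)

lemma above_roots_add: "above_roots h X \<Longrightarrow> pos_semidef Z \<Longrightarrow> above_roots h (X + Z)"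
  unfolding above_roots_def by (metis add.assoc hermitian_add pos_semidef_add pos_semidef_hermitian)

lemma pos_def_mat_1: "pos_def (mat 1)"
  using pos_def_mat[of 1] by simp

context stable_form
begin

text \<open>Along a line the barrier becomes a quotient \<open>b / a\<close> of real polynomials, to
  which the one-variable lemmas apply.\<close>

lemma line_pair:
  assumes "hermitian X" "hermitian Z"
  obtains a b where "degree a \<le> CARD('n)" "degree b \<le> CARD('n)" "coeff a CARD('n) = Re (det Z)"
    "\<And>s. h (X + s *\<^sub>C Z) = poly (cpoly a) s"
    "\<And>s. h (X + s *\<^sub>C Z + self_outer u) - h (X + s *\<^sub>C Z) = poly (cpoly b) s"
    "\<And>s. Re (h (X + s *\<^sub>R Z)) = poly a s"
    "\<And>s. poly a s \<noteq> 0 \<Longrightarrow> barrier h u (X + s *\<^sub>R Z) = poly b s / poly a s"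
proof -
  obtain a where a: "degree a \<le> CARD('n)" "coeff a CARD('n) = Re (det Z)"
    "\<And>s. h (X + s *\<^sub>C Z) = poly (cpoly a) s"
    using line[OF assms] by blast
  obtain c where c: "degree c \<le> CARD('n)" 
    "\<And>s. h (X + self_outer u + s *\<^sub>C Z) = poly (cpoly c) s"
    using line[of "X + self_outer u" Z] assms by blast
  have eq: "X + Z' + self_outer u = X + self_outer u + Z'" for Z'
    by simp
  have b: "h (X + s *\<^sub>C Z + self_outer u) - h (X + s *\<^sub>C Z) = poly (cpoly (c - a)) s" for s
  proof -
    have "cpoly (c - a) = cpoly c - cpoly a"
      by (simp add: poly_eq_iff coeff_map_poly)
    then show ?thesis
      unfolding eq c(2) a(3) by simp
  qed
  have re: "Re (h (X + s *\<^sub>R Z)) = poly a s" "Re (h (X + s *\<^sub>R Z + self_outer u)) = poly c s" for s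
    unfolding eq a(3)[of "of_real s", unfolded cscale_of_real] c(2)[of "of_real s", unfolded cscale_of_real]
    by (simp_all only: poly_cpoly complex.sel Re_complex_of_real)
  have "barrier h u (X + s *\<^sub>R Z) = poly (c - a) s / poly a s" if "poly a s \<noteq> 0" for s
    using that by (simp only: barrier_def re) (simp add: field_simps)
  moreover have "degree (c - a) \<le> CARD('n)"
    using a(1) c(1) by (simp add: degree_diff_le)
  ultimately show ?thesis
    using that[of a "c - a"] a b re(1) by blast
qed

text \<open>Stability gives \<open>b / a\<close> a nonpositive imaginary part on the upper half
  plane, hence a nonpositive derivative. Positivity is asked on the segment only, since
  \<open>pos_before_mix\<close> works where \<open>above_roots\<close> is not known.\<close>

lemma barrier_antimono_line:
  assumes "hermitian X" "pos_def Z" "l \<le> r" "\<And>s. l \<le> s \<Longrightarrow> s \<le> r \<Longrightarrow> 0 < Re (h (X + s *\<^sub>R Z))"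
  shows "barrier h u (X + r *\<^sub>R Z) \<le> barrier h u (X + l *\<^sub>R Z)"
proof -
  obtain a b where ab: 
    "\<And>s. h (X + s *\<^sub>C Z) = poly (cpoly a) s"
    "\<And>s. h (X + s *\<^sub>C Z + self_outer u) - h (X + s *\<^sub>C Z) = poly (cpoly b) s"
    "\<And>s. Re (h (X + s *\<^sub>R Z)) = poly a s"
    "\<And>s. poly a s \<noteq> 0 \<Longrightarrow> barrier h u (X + s *\<^sub>R Z) = poly b s / poly a s"
    using line_pair[OF assms(1) pos_def_hermitian[OF assms(2)]] by metis
  have pos: "poly a s > 0" if "l \<le> s" "s \<le> r" for s
    using assms(4)[OF that] ab(3) by simp
  have "poly b r / poly a r \<le> poly b l / poly a l"
  proof (rule DERIV_nonpos_imp_nonincreasing[OF assms(3)])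
    fix x assume x: "l \<le> x" "x \<le> r"
    let ?D = "(poly (pderiv b) x * poly a x - poly b x * poly (pderiv a) x) / (poly a x * poly a x)"
    have "((\<lambda>s. poly b s / poly a s) has_real_derivative ?D) (at x)"
      using pos[OF x] by (auto intro!: derivative_eq_intros)
    moreover have "?D \<le> 0"
    proof (rule ratio_deriv_nonpos)
      fix \<eta> :: real assume "\<eta> > 0"
      show "Im (poly (cpoly b) (Complex x \<eta>) / poly (cpoly a) (Complex x \<eta>)) \<le> 0"
        unfolding ab(1,2)[symmetric]
        by (rule Im_ratio_nonpos, rule nonzero_rank_one[OF assms(1,2)]) (use \<open>\<eta> > 0\<close> in auto)
    qed (use pos[OF x] in simp)
    ultimately show "\<exists>y. ((\<lambda>s. poly b s / poly a s) has_real_derivative y) (at x) \<and> y \<le> 0"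
      by blast
  qed
  then show ?thesis
    using pos[of l] pos[of r] assms(3) by (simp add: ab(4))
qed

lemma isCont_h: "isCont h X"
  using diff by (rule differentiable_imp_continuous_within)

lemma barrier_tendsto:
  assumes "(f \<longlongrightarrow> X) F" "Re (h X) \<noteq> 0"
  shows "((\<lambda>x. barrier h u (f x)) \<longlongrightarrow> barrier h u X) F"
  unfolding barrier_def
  by (intro tendsto_intros isCont_tendsto_compose[OF isCont_h] assms)

text \<open>The direction \<open>Z + \<kappa> I\<close> is positive definite; then
  \<open>\<kappa>\<close> tends to 0.\<close>

lemma barrier_antimono:
  assumes "above_roots h X" "pos_semidef Z"
  shows "barrier h u (X + Z) \<le> barrier h u X"
proof -
  have "barrier h u (X + Z + \<kappa> *\<^sub>R mat 1) \<le> barrier h u X" if "\<kappa> > 0" for \<kappa> :: real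
  proof -
    have pd: "pos_def (Z + \<kappa> *\<^sub>R mat 1)"
      using pos_def_add_semidef[OF pos_def_scaleR[OF that pos_def_mat_1] assms(2)]
      by (simp add: add.commute)
    have "barrier h u (X + 1 *\<^sub>R (Z + \<kappa> *\<^sub>R mat 1)) \<le> barrier h u (X + 0 *\<^sub>R (Z + \<kappa> *\<^sub>R mat 1))"
      using assms(1) pos_def_imp_semidef[OF pd]
      by (intro barrier_antimono_line pd) (auto simp: above_roots_def)
    then show ?thesis by (simp add: add.assoc)
  qed
  then have "\<forall>\<^sub>F \<kappa> in at_right (0::real). barrier h u (X + Z + \<kappa> *\<^sub>R mat 1) \<le> barrier h u X"
    by (auto simp: eventually_at_filter)
  moreover have "((\<lambda>\<kappa>::real. barrier h u (X + Z + \<kappa> *\<^sub>R mat 1)) \<longlongrightarrow> barrier h u (X + Z)) (at_right 0)"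
    using above_roots_pos[OF above_roots_add[OF assms]]
    by (intro barrier_tendsto) (auto intro!: tendsto_eq_intros)
  ultimately show ?thesis
    by (intro tendsto_upperbound[where F = "at_right (0::real)"]) auto
qed

text \<open>\<open>h\<close> is affine along \<open>u u^*\<close>; a negative slope would produce a
  zero above \<open>X\<close>.\<close>

lemma barrier_nonneg:
  assumes "above_roots h X"
  shows "0 \<le> barrier h u X"
proof (rule ccontr)
  define a d where "a = Re (h X)" and "d = Re (h (X + self_outer u)) - a"
  have "a > 0" using above_roots_pos[OF assms] by (simp add: a_def)
  assume "\<not> 0 \<le> barrier h u X"
  then have "d < 0"
    using \<open>a > 0\<close> by (simp add: barrier_def a_def d_def field_simps)
  have "X + (- a / d) *\<^sub>R self_outer u = X + of_real (- a / d) *\<^sub>C self_outer u"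
    by (simp only: cscale_of_real)
  then have "Re (h (X + (- a / d) *\<^sub>R self_outer u)) = a + (- a / d) * d"
    using rank_one[of X "of_real (- a / d)" u] by (simp add: a_def d_def)
  also have "\<dots> = 0" using \<open>d < 0\<close> by simp
  finally have "Re (h (X + (- a / d) *\<^sub>R self_outer u)) = 0" .
  moreover have "pos_semidef ((- a / d) *\<^sub>R self_outer u)"
    using \<open>a > 0\<close> \<open>d < 0\<close> by (intro pos_semidef_scaleR) (auto simp: field_simps)
  ultimately show False
    using assms unfolding above_roots_def by (metis less_irrefl)
qed

text \<open>Where \<open>h\<close> is positive, the average is positive exactly when the mean
  barrier is below 1.\<close>

lemma Re_mix:
  assumes "sum p S = 1" "Re (h X) \<noteq> 0"
  shows "Re (mix S p h X) = Re (h X) * (1 - (\<Sum>w\<in>S. p w * barrier h w X))"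
proof -
  have "Re (mix S p h X) = (\<Sum>w\<in>S. p w * (Re (h X) - Re (h X) * barrier h w X))"
    unfolding mix_def Re_sum using assms(2)
    by (intro sum.cong) (auto simp: rank_one_minus barrier_def field_simps)
  also have "\<dots> = sum p S * Re (h X) - Re (h X) * (\<Sum>w\<in>S. p w * barrier h w X)"
    by (simp add: right_diff_distrib sum_subtractf sum_distrib_right sum_distrib_left mult_ac)
  finally show ?thesis using assms(1) by (simp add: algebra_simps)
qed

lemma mat_minus_line: "mat (of_real x) - W = - W + x *\<^sub>R (mat 1 :: complex^'n^'n)"
  by (simp add: vec_eq_iff mat_def) (simp add: scaleR_conv_of_real)

text \<open>Otherwise there is a last point \<open>r\<close> of the ray with
  \<open>h \<le> 0\<close>, because \<open>h\<close> is positive from some \<open>c\<close> on. At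
  \<open>r\<close> all rank-one increments are still nonnegative, so each term
  \<open>h - increment\<close> of the average is at most 0, and so is the average.\<close>

lemma pos_before_mix:
  assumes "finite S" "\<And>w. w \<in> S \<Longrightarrow> p w > 0" "sum p S = 1" "hermitian W"
    and "\<And>x. x \<ge> R \<Longrightarrow> 0 < Re (mix S p h (mat (of_real x) - W))"
    and "x \<ge> R"
  shows "0 < Re (h (mat (of_real x) - W))"
proof (rule ccontr)
  define Y where "Y x = - W + x *\<^sub>R (mat 1 :: complex^'n^'n)" for x :: real
  have Y: "mat (of_real x) - W = Y x" for x
    by (simp only: Y_def mat_minus_line)
  have hW: "hermitian (- W)" using assms(4) by auto
  have hY: "hermitian (Y x)" for x
    unfolding Y_def by (intro hermitian_add hermitian_scaleR hermitian_mat_1 hW)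
  assume "\<not> 0 < Re (h (mat (of_real x) - W))"
  then have ax: "Re (h (Y x)) \<le> 0" by (simp add: Y)
  have "- W + mat (of_real x) = Y x" for x
    by (simp add: Y[symmetric])
  then obtain c where c: "\<And>x Z. x \<ge> c \<Longrightarrow> pos_semidef Z \<Longrightarrow> 0 < Re (h (Y x + Z))"
    using eventually_pos[OF hW] by metis
  have c0: "0 < Re (h (Y x))" if "x \<ge> c" for x
    using c[OF that pos_semidef_0] by simp
  have cont: "continuous_on A (\<lambda>x. Re (h (Y x)))" for A
  proof -
    have "isCont (\<lambda>x. h (Y x)) x" for x
      unfolding Y_def by (rule isCont_o2[OF _ isCont_h]) (intro continuous_intros)
    then show ?thesis
      by (intro continuous_on_Re continuous_at_imp_continuous_on) auto
  qed
  define K where "K = {x \<in> {R..c}. Re (h (Y x)) \<le> 0}"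
  have "x \<in> K"
    using ax assms(6) c0[of x] by (force simp: K_def)
  moreover have "compact K"
  proof -
    have "closedin (top_of_set {R..c}) ({R..c} \<inter> (\<lambda>x. Re (h (Y x))) -` {..0})"
      using cont[of "{R..c}"] by (intro continuous_closedin_preimage) auto
    moreover have "K = {R..c} \<inter> (\<lambda>x. Re (h (Y x))) -` {..0}"
      by (auto simp: K_def)
    ultimately show ?thesis
      using closedin_compact compact_Icc by metis
  qed
  ultimately obtain r where r: "r \<in> K" "\<And>t. t \<in> K \<Longrightarrow> t \<le> r"
    using compact_attains_sup[of K] by blast
  have "r < c" using r(1) c0[of r] by (force simp: K_def)
  have pos: "0 < Re (h (Y x))" if "x > r" for x
  proof (cases "x \<ge> c")
    case False
    moreover have "x \<notin> K" using r(2)[of x] that by force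
    ultimately show ?thesis using that r(1) by (auto simp: K_def)
  qed (rule c0)
  \<comment> \<open>To the right of \<open>r\<close> the barrier is at least its value at
    \<open>c\<close>, which is nonnegative. Increments are used instead of barriers because the
    denominator degenerates at \<open>r\<close>.\<close>
  have nonneg: "0 \<le> Re (h (Y r + self_outer w)) - Re (h (Y r))" for w
  proof -
    have "((\<lambda>x. Re (h (Y x + self_outer w)) - Re (h (Y x))) \<longlongrightarrow>
        Re (h (Y r + self_outer w)) - Re (h (Y r))) (at_right r)"
      unfolding Y_def by (intro tendsto_intros isCont_tendsto_compose[OF isCont_h])
    moreover have "0 \<le> Re (h (Y x + self_outer w)) - Re (h (Y x))" if "x > r" "x < c" for x
    proof -
      have "above_roots h (Y c)"
        using c[OF order_refl] hY by (simp add: above_roots_def)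
      then have "0 \<le> barrier h w (Y c)" by (rule barrier_nonneg)
      also have "\<dots> \<le> barrier h w (Y x)"
        unfolding Y_def
        by (intro barrier_antimono_line hW pos_def_mat_1) (use pos that in \<open>auto simp: Y_def\<close>)
      finally show ?thesis
        using pos[OF that(1)] by (simp add: barrier_def field_simps)
    qed
    then have "\<forall>\<^sub>F x in at_right r. 0 \<le> Re (h (Y x + self_outer w)) - Re (h (Y x))"
      using \<open>r < c\<close> by (auto simp: eventually_at_right)
    ultimately show ?thesis
      by (rule tendsto_lowerbound) simp
  qed
  have "Re (mix S p h (Y r)) = (\<Sum>w\<in>S. p w * (Re (h (Y r)) - (Re (h (Y r + self_outer w)) - Re (h (Y r)))))"
    by (simp add: mix_def rank_one_minus)
  also have "\<dots> \<le> 0"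
  proof (intro sum_nonpos mult_nonneg_nonpos)
    fix w
    have "Re (h (Y r)) \<le> 0" using r(1) by (simp add: K_def)
    with nonneg[of w] show "Re (h (Y r)) - (Re (h (Y r + self_outer w)) - Re (h (Y r))) \<le> 0"
      by linarith
  qed (use assms(2) in \<open>auto intro: less_imp_le\<close>)
  finally show False
    using assms(5)[of r] r(1) by (simp add: K_def Y)
qed

text \<open>At \<open>R\<close> the mean barrier is below 1, so some \<open>w\<close> has barrier
  below 1 there, and by monotonicity on the whole ray. Translating by \<open>- w w^*\<close>
  multiplies \<open>h\<close> by 1 minus this barrier.\<close>

lemma interlacing:
  assumes "finite S" "\<And>w. w \<in> S \<Longrightarrow> p w > 0" "sum p S = 1" "hermitian W"
    and "\<And>x. x \<ge> R \<Longrightarrow> 0 < Re (mix S p h (mat (of_real x) - W))"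
  obtains w where "w \<in> S" "\<And>x. x \<ge> R \<Longrightarrow> 0 < Re (h (mat (of_real x) - (W + self_outer w)))"
proof -
  define Y where "Y x = - W + x *\<^sub>R (mat 1 :: complex^'n^'n)" for x :: real
  have Y: "mat (of_real x) - W = Y x" for x
    by (simp only: Y_def mat_minus_line)
  have pos: "0 < Re (h (Y x))" if "x \<ge> R" for x
    using pos_before_mix[OF assms that] by (simp add: Y)
  have "0 < Re (mix S p h (Y R))"
    using assms(5)[of R] by (simp add: Y)
  then have "0 < (1 - (\<Sum>w\<in>S. p w * barrier h w (Y R)))"
    using pos[of R] Re_mix[OF assms(3), of "Y R"] by (simp add: zero_less_mult_iff)
  then have "(\<Sum>w\<in>S. p w * barrier h w (Y R)) < 1" by simp
  have "\<exists>w\<in>S. barrier h w (Y R) < 1"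
  proof (rule ccontr)
    assume "\<not> (\<exists>w\<in>S. barrier h w (Y R) < 1)"
    then have "sum p S \<le> (\<Sum>w\<in>S. p w * barrier h w (Y R))"
      using assms(2) by (intro sum_mono) (auto simp: not_less less_imp_le)
    then show False
      using \<open>(\<Sum>w\<in>S. p w * barrier h w (Y R)) < 1\<close> assms(3) by simp
  qed
  then obtain w where w: "w \<in> S" "barrier h w (Y R) < 1" by blast
  have "0 < Re (h (mat (of_real x) - (W + self_outer w)))" if "x \<ge> R" for x
  proof -
    have "barrier h w (Y x) \<le> barrier h w (Y R)"
      unfolding Y_def
      by (intro barrier_antimono_line pos_def_mat_1 hermitian_uminus assms(4))
        (use pos that in \<open>auto simp: Y_def\<close>)
    with w(2) have "barrier h w (Y x) < 1" by linarith
    then have "0 < Re (h (Y x - self_outer w))"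
      using pos[OF that] by (simp add: rank_one_minus barrier_def field_simps)
    then show ?thesis by (simp add: Y[symmetric] diff_diff_eq)
  qed
  with w(1) show ?thesis using that by blast
qed

end

section \<open>Convexity of the barrier\<close>

lemma poly_root_exists:
  fixes P :: "complex poly"
  assumes "degree P \<noteq> 0"
  obtains r Q where "P = [:- r, 1:] * Q" "degree P = Suc (degree Q)" "poly P r = 0"
proof -
  obtain r where r: "poly P r = 0"
    using fundamental_theorem_of_algebra_alt[of P] assms by force
  then obtain Q where Q: "P = [:- r, 1:] * Q"
    using poly_eq_0_iff_dvd dvdE by blast
  moreover have "P \<noteq> 0" using assms by auto
  ultimately have "degree P = Suc (degree Q)"
    by (auto simp: degree_mult_eq simp del: mult_pCons_left)
  with that r Q show ?thesis by blast
qed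

text \<open>The quantity below is \<open>-(log P)''\<close>, that is, the sum of \<open>1/(x - r)\<^sup>2\<close> over the roots \<open>r\<close>.\<close>

lemma Im_log_deriv2_nonpos:
  fixes P :: "complex poly"
  assumes "poly P (of_real x) \<noteq> 0" "\<And>r. poly P r = 0 \<Longrightarrow> Re r \<le> x \<and> Im r \<le> 0"
  shows "Im (((poly (pderiv P) (of_real x))\<^sup>2 - poly (pderiv (pderiv P)) (of_real x) * poly P (of_real x))
    / (poly P (of_real x))\<^sup>2) \<le> 0"
  using assms
proof (induction "degree P" arbitrary: P)
  case 0
  then obtain c where "P = [:c:]" by (metis degree_eq_zeroE)
  then show ?case by (simp add: pderiv_pCons)
next
  case (Suc n)
  obtain r Q where rQ: "P = [:- r, 1:] * Q" "degree P = Suc (degree Q)" "poly P r = 0"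
    using poly_root_exists Suc.hyps(2) by (metis nat.distinct(1))
  define z where "z = of_real x - r"
  define q q1 q2 where "q = poly Q (of_real x)" and "q1 = poly (pderiv Q) (of_real x)"
    and "q2 = poly (pderiv (pderiv Q)) (of_real x)"
  have "z \<noteq> 0" "q \<noteq> 0"
    using Suc.prems(1) by (auto simp: rQ(1) z_def q_def)
  have IH: "Im ((q1\<^sup>2 - q2 * q) / q\<^sup>2) \<le> 0"
    unfolding q_def q1_def q2_def
    by (rule Suc.hyps(1)) (use Suc rQ \<open>q \<noteq> 0\<close> q_def in auto)
  have "poly P (of_real x) = z * q"
    by (simp add: rQ(1) z_def q_def algebra_simps)
  moreover have "poly (pderiv P) (of_real x) = q + z * q1"
    unfolding rQ(1) pderiv_mult by (simp add: z_def q_def q1_def pderiv_pCons algebra_simps)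
  moreover have "poly (pderiv (pderiv P)) (of_real x) = 2 * q1 + z * q2"
    unfolding rQ(1) pderiv_mult pderiv_add
    by (simp add: z_def q1_def q2_def pderiv_pCons pderiv_mult pderiv_add pderiv_minus pderiv_smult algebra_simps)
  ultimately have "((poly (pderiv P) (of_real x))\<^sup>2 - poly (pderiv (pderiv P)) (of_real x) * poly P (of_real x))
    / (poly P (of_real x))\<^sup>2 = ((q + z * q1)\<^sup>2 - (2 * q1 + z * q2) * (z * q)) / (z * q)\<^sup>2"
    by simp
  also have "(q + z * q1)\<^sup>2 - (2 * q1 + z * q2) * (z * q) = q\<^sup>2 + z\<^sup>2 * (q1\<^sup>2 - q2 * q)"
    by (simp add: power2_eq_square algebra_simps)
  also have "(q\<^sup>2 + z\<^sup>2 * (q1\<^sup>2 - q2 * q)) / (z * q)\<^sup>2 = (1 / z)\<^sup>2 + (q1\<^sup>2 - q2 * q) / q\<^sup>2"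
    using \<open>z \<noteq> 0\<close> \<open>q \<noteq> 0\<close> by (simp add: field_simps)
  finally have "Im (((poly (pderiv P) (of_real x))\<^sup>2 - poly (pderiv (pderiv P)) (of_real x) * poly P (of_real x))
    / (poly P (of_real x))\<^sup>2) = Im ((1 / z)\<^sup>2) + Im ((q1\<^sup>2 - q2 * q) / q\<^sup>2)"
    by simp
  \<comment> \<open>\<open>z\<close> lies in the closed first quadrant, so \<open>1 / z\<close> lies
    in the fourth and its square in the lower half plane.\<close>
  moreover have "Im ((1 / z)\<^sup>2) \<le> 0"
  proof -
    have "Re z \<ge> 0" "Im z \<ge> 0"
      using Suc.prems(2)[OF rQ(3)] by (auto simp: z_def)
    then have "Re (1 / z) \<ge> 0" "Im (1 / z) \<le> 0"
      by (auto simp: Re_divide Im_divide intro!: divide_nonneg_nonneg divide_nonpos_nonneg)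
    moreover have "Im (w\<^sup>2) = 2 * Re w * Im w" for w
      by (simp add: power2_eq_square)
    ultimately show ?thesis
      by (simp only: mult_nonneg_nonpos mult_nonneg_nonneg zero_le_numeral)
  qed
  ultimately show ?case
    using IH by linarith
qed

text \<open>\<open>q / p\<close> has no pole in the closed right half plane and stays bounded at
  infinity. The bound \<open>C\<close> shows how small a perturbation of \<open>p\<close> by
  \<open>q\<close> must be to keep all roots on the left.\<close>

lemma bounded_by_stable_poly:
  fixes p q :: "complex poly"
  assumes "p \<noteq> 0" "degree q \<le> degree p" "\<And>r. poly p r = 0 \<Longrightarrow> Re r < 0"
  shows "\<exists>C \<ge> 0. \<forall>s. Re s \<ge> 0 \<longrightarrow> norm (poly q s) \<le> C * norm (poly p s)"
  using assms
proof (induction "degree p" arbitrary: p q)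
  case 0
  then obtain c d where "p = [:c:]" "q = [:d:]" by (metis degree_eq_zeroE le_zero_eq)
  with 0 show ?case by (intro exI[of _ "norm d / norm c"]) auto
next
  case (Suc n)
  obtain r P where rP: "p = [:- r, 1:] * P" "degree p = Suc (degree P)" "poly p r = 0"
    using poly_root_exists Suc.hyps(2) by (metis nat.distinct(1))
  have r: "Re r < 0" using Suc.prems(3) rP(3) by blast
  define Q where "Q = synthetic_div q r"
  have q: "q = [:- r, 1:] * Q + [:poly q r:]"
    by (simp add: Q_def synthetic_div_correct' del: mult_pCons_left)
  have P: "n = degree P" "P \<noteq> 0" "\<And>r. poly P r = 0 \<Longrightarrow> Re r < 0"
    using Suc rP by auto
  have "degree Q \<le> degree P"
    using Suc.prems(2) rP(2) by (simp add: Q_def degree_synthetic_div)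
  then obtain C where C: "C \<ge> 0" "\<And>s. Re s \<ge> 0 \<Longrightarrow> norm (poly Q s) \<le> C * norm (poly P s)"
    using Suc.hyps(1)[OF P(1,2) _ P(3)] by blast
  \<comment> \<open>The induction hypothesis for the constant 1 bounds the remainder
    \<open>poly q r\<close> of the division by \<open>s - r\<close>.\<close>
  obtain D where D: "D \<ge> 0" "\<And>s. Re s \<ge> 0 \<Longrightarrow> 1 \<le> D * norm (poly P s)"
    using Suc.hyps(1)[OF P(1,2) _ P(3), of 1] by auto
  \<comment> \<open>The remainder lacks the factor \<open>s - r\<close> of \<open>p\<close>; it is
    supplied by \<open>norm (s - r) \<ge> - Re r\<close>.\<close>
  define E where "E = C + norm (poly q r) * D / (- Re r)"
  have "norm (poly q s) \<le> E * norm (poly p s)" if s: "Re s \<ge> 0" for s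
  proof -
    have sr: "- Re r \<le> norm (s - r)"
      using s complex_Re_le_cmod[of "s - r"] by simp
    have p: "poly p s = (s - r) * poly P s"
      by (simp add: rP(1) algebra_simps)
    have "poly q s = (s - r) * poly Q s + poly q r"
      by (subst q) (simp add: algebra_simps)
    then have "norm (poly q s) \<le> norm (s - r) * norm (poly Q s) + norm (poly q r)"
      by (metis norm_triangle_ineq norm_mult)
    moreover have "norm (s - r) * norm (poly Q s) \<le> norm (s - r) * (C * norm (poly P s))"
      by (intro mult_left_mono C s) simp
    moreover have "norm (poly q r) * 1 \<le> norm (poly q r) * (D * norm (poly P s) * (norm (s - r) / (- Re r)))"
    proof (intro mult_left_mono)
      have "1 \<le> norm (s - r) / (- Re r)"
        using sr r by (simp add: field_simps)
      then have "1 * 1 \<le> D * norm (poly P s) * (norm (s - r) / (- Re r))"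
        using D(2)[OF s] by (intro mult_mono) auto
      then show "1 \<le> D * norm (poly P s) * (norm (s - r) / (- Re r))" by simp
    qed simp
    moreover have "E * norm (poly p s) = norm (s - r) * (C * norm (poly P s)) +
        norm (poly q r) * (D * norm (poly P s) * (norm (s - r) / (- Re r)))"
      unfolding p norm_mult E_def by (simp add: field_simps)
    ultimately show ?thesis by linarith
  qed
  moreover have "E \<ge> 0"
    unfolding E_def using C(1) D(1) r
    by (intro add_nonneg_nonneg divide_nonneg_pos mult_nonneg_nonneg) auto
  ultimately show ?case by blast
qed

text \<open>The roots in \<open>s\<close> of \<open>a(s) + \<i> \<eta> (b(s) - c a(s))\<close> have negative real part for small \<open>\<eta>\<close> and lie
  in the closed lower half plane by stability, so \<open>Im\<close> of \<open>-(log)''\<close> at \<open>x\<close> is nonpositive; with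
  \<open>c = b(x)/a(x)\<close> this imaginary part is \<open>-\<eta> (b/a)''(x)\<close>.\<close>

lemma ratio_deriv2_nonneg:
  fixes a b :: "real poly"
  assumes stable: "\<And>s t. Im s > 0 \<Longrightarrow> Im t \<ge> 0 \<Longrightarrow> poly (cpoly a) s + t * poly (cpoly b) s \<noteq> 0"
    and pos: "\<And>s. s \<ge> 0 \<Longrightarrow> poly a s > 0"
    and deg: "degree b \<le> degree a" and x: "x \<ge> 0"
  defines "c \<equiv> poly b x / poly a x"
  shows "2 * poly (pderiv a) x * (poly (pderiv b) x - c * poly (pderiv a) x)
    \<le> poly a x * (poly (pderiv (pderiv b)) x - c * poly (pderiv (pderiv a)) x)"
proof -
  define A B where "A = cpoly a" and "B = cpoly b"
  \<comment> \<open>Stability with \<open>t = 0\<close> and conjugation exclude nonreal roots;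
    positivity excludes real roots at or right of 0.\<close>
  have A_root: "Re s < 0" if "poly A s = 0" for s
  proof (rule ccontr)
    assume "\<not> Re s < 0"
    have "\<not> Im s > 0" using stable[of s 0] that by (auto simp: A_def)
    moreover have "poly A (cnj s) = cnj (poly A s)"
      unfolding A_def by (intro poly_cnj_real[symmetric]) (auto simp: coeff_map_poly)
    then have "\<not> Im s < 0" using stable[of "cnj s" 0] that by (auto simp: A_def)
    ultimately have "s = of_real (Re s)" by (simp add: complex_eq_iff)
    then have "poly A s = of_real (poly a (Re s))" unfolding A_def by (metis poly_cpoly)
    with that pos[of "Re s"] \<open>\<not> Re s < 0\<close> show False by simp
  qed
  have ax: "poly a x > 0" using pos x by blast
  have "degree A = degree a" "degree B = degree b"
    by (simp_all add: A_def B_def degree_map_poly)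
  moreover have "A \<noteq> 0"
    using ax poly_cpoly[of a x] by (auto simp: A_def simp del: poly_cpoly)
  ultimately obtain C where C: "C \<ge> 0" "\<And>s. Re s \<ge> 0 \<Longrightarrow> norm (poly B s) \<le> C * norm (poly A s)"
    using bounded_by_stable_poly[of A B] A_root deg by auto
  \<comment> \<open>Any positive value with \<open>\<eta> * C < 1\<close> would do: a root of
    \<open>P\<close> on the right would give \<open>|A| \<le> \<eta> * C * |A|\<close> with
    \<open>A \<noteq> 0\<close> there.\<close>
  define \<eta> where "\<eta> = 1 / (C + 1)"
  have \<eta>: "\<eta> > 0" "\<eta> * C < 1" using C(1) by (auto simp: \<eta>_def field_simps)
  define P where "P = A + smult (\<i> * of_real \<eta>) (B - smult (of_real c) A)"
  define a1 a2 b1 b2 where "a1 = poly (pderiv a) x" and "a2 = poly (pderiv (pderiv a)) x"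
    and "b1 = poly (pderiv b) x - c * a1" and "b2 = poly (pderiv (pderiv b)) x - c * a2"
  have pderiv_c: "pderiv (cpoly p) = cpoly (pderiv p)" for p
    by (simp add: poly_eq_iff coeff_pderiv coeff_map_poly)
  have P0: "poly P (of_real x) = of_real (poly a x)"
    using ax by (simp add: P_def A_def B_def c_def)
  have P1: "poly (pderiv P) (of_real x) = of_real a1 + \<i> * of_real \<eta> * of_real b1"
    by (simp add: P_def A_def B_def a1_def b1_def pderiv_add pderiv_smult pderiv_diff)
  have P2: "poly (pderiv (pderiv P)) (of_real x) = of_real a2 + \<i> * of_real \<eta> * of_real b2"
    by (simp add: P_def A_def B_def a2_def b2_def pderiv_add pderiv_smult pderiv_diff pderiv_c)
  have roots: "Re r \<le> x \<and> Im r \<le> 0" if "poly P r = 0" for r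
  proof -
    \<comment> \<open>\<open>P = d A + \<i> \<eta> B\<close>. Dividing by \<open>d\<close> gives
      \<open>A + t B\<close> with \<open>Im t > 0\<close>, as stability requires, and
      \<open>|t| \<le> \<eta>\<close> because \<open>Re d = 1\<close>.\<close>
    define d where "d = 1 - \<i> * of_real (\<eta> * c)"
    define t where "t = \<i> * of_real \<eta> / d"
    have "Re d = 1" by (simp add: d_def)
    then have "d \<noteq> 0" by auto
    have "norm d \<ge> 1" using complex_Re_le_cmod[of d] \<open>Re d = 1\<close> by simp
    have "d * poly A r + \<i> * of_real \<eta> * poly B r = 0"
      using that by (simp add: P_def d_def algebra_simps)
    then have zero: "poly A r + t * poly B r = 0"
      using \<open>d \<noteq> 0\<close> by (simp add: t_def field_simps)
    have "Im t = \<eta> / (norm d)\<^sup>2"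
      unfolding t_def by (simp add: Im_divide cmod_def \<open>Re d = 1\<close>)
    then have "Im t \<ge> 0" using \<eta> by simp
    then have "Im r \<le> 0"
      using stable[of r t] zero by (force simp: A_def B_def)
    moreover have "Re r < 0"
    proof (rule ccontr)
      assume "\<not> Re r < 0"
      have "norm t \<le> \<eta>"
        using divide_left_mono[of 1 "norm d" \<eta>] \<open>norm d \<ge> 1\<close> \<open>d \<noteq> 0\<close> \<eta>
        by (simp add: t_def norm_divide norm_mult)
      have "poly A r = - (t * poly B r)" using zero by (simp add: eq_neg_iff_add_eq_0)
      then have "norm (poly A r) = norm t * norm (poly B r)" by (simp add: norm_mult)
      also have "\<dots> \<le> \<eta> * (C * norm (poly A r))"
        using \<open>norm t \<le> \<eta>\<close> C(2)[of r] \<open>\<not> Re r < 0\<close> \<eta> by (intro mult_mono) auto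
      finally have "1 * norm (poly A r) \<le> (\<eta> * C) * norm (poly A r)" by simp
      moreover have "norm (poly A r) > 0" using A_root[of r] \<open>\<not> Re r < 0\<close> by auto
      ultimately show False using \<eta>(2) mult_le_cancel_right_pos by (metis not_le)
    qed
    ultimately show ?thesis using x by simp
  qed
  have "poly P (of_real x) \<noteq> 0" using P0 ax by simp
  from Im_log_deriv2_nonpos[OF this roots]
  have "Im (((of_real a1 + \<i> * of_real \<eta> * of_real b1)\<^sup>2 -
      (of_real a2 + \<i> * of_real \<eta> * of_real b2) * of_real (poly a x)) / (of_real (poly a x))\<^sup>2) \<le> 0"
    by (simp only: P0 P1 P2)
  then have "Im (((of_real a1 + \<i> * of_real \<eta> * of_real b1)\<^sup>2 -
      (of_real a2 + \<i> * of_real \<eta> * of_real b2) * of_real (poly a x)) / of_real ((poly a x)\<^sup>2)) \<le> 0"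
    by (simp only: of_real_power)
  then have "(2 * a1 * (\<eta> * b1) - \<eta> * b2 * poly a x) / (poly a x)\<^sup>2 \<le> 0"
    unfolding Im_divide_of_real by (simp add: power2_eq_square[of "_ + _"] algebra_simps)
  then have "\<eta> * (2 * a1 * b1 - b2 * poly a x) \<le> 0"
    using ax by (simp add: divide_le_0_iff algebra_simps)
  then have "2 * a1 * b1 \<le> b2 * poly a x"
    using \<eta>(1) by (simp add: mult_le_0_iff)
  then show ?thesis
    by (simp add: a1_def a2_def b1_def b2_def mult_ac)
qed

context stable_form
begin

lemma barrier_convex_pos_def:
  assumes "above_roots h X" "pos_def Z"
  shows "convex_on {0..} (\<lambda>s. barrier h u (X + s *\<^sub>R Z))"
proof -
  have X: "hermitian X" using assms(1) by (simp add: above_roots_def)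
  obtain a b where ab: "degree a \<le> CARD('n)" "degree b \<le> CARD('n)" "coeff a CARD('n) = Re (det Z)"
    "\<And>s. h (X + s *\<^sub>C Z) = poly (cpoly a) s"
    "\<And>s. h (X + s *\<^sub>C Z + self_outer u) - h (X + s *\<^sub>C Z) = poly (cpoly b) s"
    "\<And>s. Re (h (X + s *\<^sub>R Z)) = poly a s"
    "\<And>s. poly a s \<noteq> 0 \<Longrightarrow> barrier h u (X + s *\<^sub>R Z) = poly b s / poly a s"
    using line_pair[OF X pos_def_hermitian[OF assms(2)], of u] by metis
  have pos: "poly a s > 0" if "s \<ge> 0" for s
  proof -
    have "pos_semidef (s *\<^sub>R Z)"
      using that assms(2) by (intro pos_semidef_scaleR pos_def_imp_semidef)
    then show ?thesis
      using assms(1) by (simp add: above_roots_def flip: ab(6))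
  qed
  \<comment> \<open>\<open>a\<close> has full degree because its coefficient at
    \<open>CARD('n)\<close> is \<open>det Z > 0\<close>; thus
    \<open>degree b \<le> degree a\<close>, as \<open>ratio_deriv2_nonneg\<close> requires.\<close>
  have "coeff a CARD('n) \<noteq> 0"
    using det_pos_def[OF assms(2)] ab(3) by simp
  then have deg: "degree b \<le> degree a"
    using le_degree[of a "CARD('n)"] ab(2) by linarith
  define a1 a2 b1 b2 where "a1 = pderiv a" and "a2 = pderiv (pderiv a)"
    and "b1 = pderiv b" and "b2 = pderiv (pderiv b)"
  define f1 where "f1 = (\<lambda>s. (poly b1 s * poly a s - poly b s * poly a1 s) / (poly a s * poly a s))"
  define f2 where "f2 = (\<lambda>s. (poly b2 s * poly a s - poly b s * poly a2 s) / (poly a s * poly a s)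
      - 2 * poly a1 s * (poly b1 s * poly a s - poly b s * poly a1 s) / (poly a s) ^ 3)"
  have "convex_on {0..} (\<lambda>s. poly b s / poly a s)"
  proof (rule f''_ge0_imp_convex)
    fix x :: real assume "x \<in> {0..}"
    then have x: "x \<ge> 0" by simp
    note nz = pos[OF x]
    show "((\<lambda>s. poly b s / poly a s) has_real_derivative f1 x) (at x)"
      unfolding f1_def a1_def b1_def using nz by (auto intro!: derivative_eq_intros)
    show "(f1 has_real_derivative f2 x) (at x)"
      unfolding f1_def using nz
      by (auto intro!: derivative_eq_intros
          simp: f2_def a1_def a2_def b1_def b2_def field_simps power2_eq_square power3_eq_cube)
    define c where "c = poly b x / poly a x"
    have bx: "poly b x = c * poly a x" using nz by (simp add: c_def)
    have "2 * poly a1 x * (poly b1 x - c * poly a1 x) \<le> poly a x * (poly b2 x - c * poly a2 x)"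
      unfolding c_def a1_def a2_def b1_def b2_def
    proof (rule ratio_deriv2_nonneg[OF _ pos deg x])
      show "poly (cpoly a) s + t * poly (cpoly b) s \<noteq> 0" if "Im s > 0" "Im t \<ge> 0" for s t
        unfolding ab(4,5)[symmetric] by (rule nonzero_rank_one[OF X assms(2) that])
    qed
    moreover have "f2 x = (poly a x * (poly b2 x - c * poly a2 x) -
        2 * poly a1 x * (poly b1 x - c * poly a1 x)) / (poly a x)\<^sup>2"
      unfolding f2_def bx using nz by (simp add: field_simps power2_eq_square power3_eq_cube)
    ultimately show "f2 x \<ge> 0" by simp
  qed simp
  moreover have "barrier h u (X + s *\<^sub>R Z) = poly b s / poly a s" if "s \<ge> 0" for s
    using pos[OF that] by (simp add: ab(7))
  ultimately show ?thesis
    unfolding convex_on_def by simp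
qed

text \<open>Convexity at the points \<open>0 < \<delta> < \<delta> + r\<close> with denominators
  cleared, a form that survives the limit from \<open>Z + \<kappa> I\<close> to
  \<open>Z\<close>.\<close>

lemma barrier_convex:
  assumes "above_roots h X" "pos_semidef Z" "\<delta> > 0" "r > 0"
  shows "(\<delta> + r) * barrier h u (X + \<delta> *\<^sub>R Z) \<le>
    r * barrier h u X + \<delta> * barrier h u (X + (\<delta> + r) *\<^sub>R Z)"
proof -
  have ineq: "(\<delta> + r) * barrier h u (X + \<delta> *\<^sub>R (Z + \<kappa> *\<^sub>R mat 1)) \<le>
    r * barrier h u X + \<delta> * barrier h u (X + (\<delta> + r) *\<^sub>R (Z + \<kappa> *\<^sub>R mat 1))" if "\<kappa> > 0" for \<kappa> :: real
  proof -
    have "pos_def (Z + \<kappa> *\<^sub>R mat 1)"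
      using pos_def_add_semidef[OF pos_def_scaleR[OF that pos_def_mat_1] assms(2)]
      by (simp add: add.commute)
    note convex_onD[OF barrier_convex_pos_def[OF assms(1) this, of u], of "\<delta> / (\<delta> + r)" 0 "\<delta> + r"]
    moreover have "1 - \<delta> / (\<delta> + r) = r / (\<delta> + r)"
      using assms(3,4) by (simp add: field_simps)
    ultimately have "barrier h u (X + \<delta> *\<^sub>R (Z + \<kappa> *\<^sub>R mat 1)) \<le>
        r / (\<delta> + r) * barrier h u X + \<delta> / (\<delta> + r) * barrier h u (X + (\<delta> + r) *\<^sub>R (Z + \<kappa> *\<^sub>R mat 1))"
      using assms(3,4) by simp
    also have "\<dots> = (r * barrier h u X + \<delta> * barrier h u (X + (\<delta> + r) *\<^sub>R (Z + \<kappa> *\<^sub>R mat 1))) / (\<delta> + r)"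
      by (simp add: add_divide_distrib)
    finally show ?thesis
      using assms(3,4) by (simp add: field_simps)
  qed
  have lim: "((\<lambda>\<kappa>::real. barrier h u (X + s *\<^sub>R (Z + \<kappa> *\<^sub>R mat 1))) \<longlongrightarrow> barrier h u (X + s *\<^sub>R Z)) (at_right 0)"
    if "s \<ge> 0" for s
    using above_roots_pos[OF above_roots_add[OF assms(1) pos_semidef_scaleR[OF that assms(2)]]]
    by (intro barrier_tendsto) (auto intro!: tendsto_eq_intros)
  have "\<forall>\<^sub>F \<kappa> in at_right (0::real). (\<delta> + r) * barrier h u (X + \<delta> *\<^sub>R (Z + \<kappa> *\<^sub>R mat 1)) \<le>
      r * barrier h u X + \<delta> * barrier h u (X + (\<delta> + r) *\<^sub>R (Z + \<kappa> *\<^sub>R mat 1))"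
    using ineq by (auto simp: eventually_at_filter)
  then show ?thesis
    using assms(3,4)
    by (intro tendsto_le[OF _ tendsto_add[OF tendsto_const tendsto_mult[OF tendsto_const lim]]
        tendsto_mult[OF tendsto_const lim]]) auto
qed

text \<open>By the chain rule \<open>h - D\<^sub>A h = E h(\<cdot> - w w\<^sup>*)\<close> for \<open>A = E w w\<^sup>*\<close>.\<close>

lemma has_derivative_mix:
  assumes "finite S" "sum p S = 1"
  shows "((\<lambda>r. h (Y + r *\<^sub>R (\<Sum>w\<in>S. p w *\<^sub>R self_outer w))) has_vector_derivative
    (h Y - mix S p h Y)) (at 0)"
proof -
  obtain D where D: "(h has_derivative D) (at Y)"
    using diff by (auto simp: differentiable_def)
  have lin: "linear D" by (rule has_derivative_linear[OF D])
  have along: "((\<lambda>r. h (Y + r *\<^sub>R A)) has_vector_derivative D A) (at 0)" for A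
  proof -
    have "((\<lambda>r::real. Y + r *\<^sub>R A) has_derivative (\<lambda>r. r *\<^sub>R A)) (at 0)"
      by (auto intro!: derivative_eq_intros)
    then have "((\<lambda>r::real. h (Y + r *\<^sub>R A)) has_derivative (\<lambda>r. D (r *\<^sub>R A))) (at 0)"
      using has_derivative_compose[of "\<lambda>r. Y + r *\<^sub>R A" _ 0 UNIV h D] D by simp
    then show ?thesis
      by (simp add: has_vector_derivative_def linear_scale[OF lin])
  qed
  \<comment> \<open>In rank-one directions the derivative is the full increment; linearity of
    \<open>D\<close> extends this to the weighted sum.\<close>
  have "D (self_outer w) = h (Y + self_outer w) - h Y" for w
  proof (rule vector_derivative_unique_at[OF along])
    have "h (Y + r *\<^sub>R self_outer w) = h Y + r *\<^sub>R (h (Y + self_outer w) - h Y)" for r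
      using rank_one[of Y "of_real r" w] unfolding cscale_of_real by (simp add: scaleR_conv_of_real)
    then show "((\<lambda>r. h (Y + r *\<^sub>R self_outer w)) has_vector_derivative h (Y + self_outer w) - h Y) (at 0)"
      by (auto intro!: derivative_eq_intros simp: has_vector_derivative_def)
  qed
  then have "D (\<Sum>w\<in>S. p w *\<^sub>R self_outer w) = (\<Sum>w\<in>S. p w *\<^sub>R (h (Y + self_outer w) - h Y))"
    by (simp add: linear_sum[OF lin] linear_scale[OF lin])
  also have "\<dots> = h Y - mix S p h Y"
  proof -
    have "h Y = (\<Sum>w\<in>S. of_real (p w) * h Y)"
      using assms(2) by (metis mult_1 of_real_1 of_real_sum sum_distrib_right)
    then have "h Y - mix S p h Y = (\<Sum>w\<in>S. of_real (p w) * h Y) - (\<Sum>w\<in>S. of_real (p w) * h (Y - self_outer w))"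
      by (simp add: mix_def)
    also have "\<dots> = (\<Sum>w\<in>S. p w *\<^sub>R (h (Y + self_outer w) - h Y))"
      unfolding sum_subtractf[symmetric] rank_one_minus
      by (intro sum.cong) (auto simp: scaleR_conv_of_real algebra_simps)
    finally show ?thesis by simp
  qed
  finally show ?thesis using along by metis
qed

text \<open>By \<open>has_derivative_mix\<close>, \<open>D\<close> is the derivative at
  \<open>Y\<close> of the barrier along \<open>A\<close>. It is nonpositive by monotonicity, and by
  convexity the tangent at \<open>Y\<close> lies below the barrier at
  \<open>X = Y - \<delta> A\<close>.\<close>

lemma barrier_mix_le_tangent:
  fixes u :: "complex^'n"
  assumes "finite S" "sum p S = 1" "\<And>w. w \<in> S \<Longrightarrow> p w > 0" "above_roots h X" "\<delta> > 0"
  defines "A \<equiv> (\<Sum>w\<in>S. p w *\<^sub>R self_outer w)"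
  defines "Y \<equiv> X + \<delta> *\<^sub>R A"
  defines "D \<equiv> (Re (h (Y + self_outer u)) * Re (mix S p h Y) - Re (mix S p h (Y + self_outer u)) * Re (h Y)) / (Re (h Y))\<^sup>2"
  shows "D \<le> 0" "barrier h u Y - \<delta> * D \<le> barrier h u X"
proof -
  have A: "pos_semidef A"
    unfolding A_def using assms(3) by (intro pos_semidef_sum pos_semidef_scaleR) (auto intro: less_imp_le)
  have Y: "above_roots h Y"
    unfolding Y_def using assms(5) A by (intro above_roots_add assms(4) pos_semidef_scaleR) auto
  define f where "f r = barrier h u (Y + r *\<^sub>R A)" for r :: real
  have re: "((\<lambda>r. Re (h (V + r *\<^sub>R A))) has_real_derivative Re (h V) - Re (mix S p h V)) (at 0)" for V
    using bounded_linear.has_vector_derivative[OF bounded_linear_Re has_derivative_mix[OF assms(1,2), of V]]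
    unfolding A_def has_real_derivative_iff_has_vector_derivative by simp
  have g: "((\<lambda>r. Re (h (Y + r *\<^sub>R A + self_outer u))) has_real_derivative
      Re (h (Y + self_outer u)) - Re (mix S p h (Y + self_outer u))) (at 0)"
    using re[of "Y + self_outer u"] by (simp add: ac_simps)
  have "(f has_real_derivative D) (at 0)"
    unfolding f_def barrier_def D_def
    by (rule derivative_eq_intros g re refl)+
      (use above_roots_pos[OF Y] in \<open>auto simp: power2_eq_square algebra_simps\<close>)
  then have lim: "((\<lambda>r. (f r - f 0) / r) \<longlongrightarrow> D) (at_right 0)"
    unfolding has_field_derivative_iff by (simp add: filterlim_at_split)
  have "(f r - f 0) / r \<le> 0" if "r > 0" for r
    using barrier_antimono[OF Y pos_semidef_scaleR[OF less_imp_le[OF that] A]] that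
    by (simp add: f_def divide_nonpos_pos)
  then have "\<forall>\<^sub>F r in at_right 0. (f r - f 0) / r \<le> 0"
    by (auto simp: eventually_at_filter)
  with lim show "D \<le> 0"
    by (rule tendsto_upperbound) simp
  \<comment> \<open>Slopes of a convex function increase: the slope from \<open>X\<close> to
    \<open>Y\<close> is at most every slope to the right of \<open>Y\<close>.\<close>
  have "(f 0 - barrier h u X) / \<delta> \<le> (f r - f 0) / r" if "r > 0" for r
  proof -
    have "(\<delta> + r) * f 0 \<le> r * barrier h u X + \<delta> * f r"
      using barrier_convex[OF assms(4) A assms(5) that, of u]
      by (simp add: f_def Y_def scaleR_add_left add.assoc)
    then show ?thesis
      using that assms(5) by (simp add: field_simps)
  qed
  then have "\<forall>\<^sub>F r in at_right 0. (f 0 - barrier h u X) / \<delta> \<le> (f r - f 0) / r"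
    by (auto simp: eventually_at_filter)
  with lim have "(f 0 - barrier h u X) / \<delta> \<le> D"
    by (rule tendsto_lowerbound) simp
  then show "barrier h u Y - \<delta> * D \<le> barrier h u X"
    using assms(5) by (simp add: f_def field_simps)
qed

text \<open>With \<open>a\<close>, \<open>m\<close> the values at \<open>Y\<close> of
  \<open>h\<close> and of the average, the barrier of the average is that of \<open>h\<close> minus
  \<open>(a / m) * D\<close>. The bound on the mean barrier gives
  \<open>a / m \<le> \<delta>\<close>; as \<open>D \<le> 0\<close>, the tangent inequality absorbs
  the correction.\<close>

lemma barrier_step:
  assumes "finite S" "sum p S = 1" "\<And>w. w \<in> S \<Longrightarrow> p w > 0" "above_roots h X" "\<delta> > 0"
    and "(\<Sum>w\<in>S. p w * barrier h w X) \<le> 1 - 1 / \<delta>"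
  defines "Y \<equiv> X + \<delta> *\<^sub>R (\<Sum>w\<in>S. p w *\<^sub>R self_outer w)"
  shows "above_roots (mix S p h) Y" "barrier (mix S p h) u Y \<le> barrier h u X"
proof -
  have A: "pos_semidef (\<delta> *\<^sub>R (\<Sum>w\<in>S. p w *\<^sub>R self_outer w))"
    using assms(3,5) by (intro pos_semidef_sum pos_semidef_scaleR) (auto intro: less_imp_le)
  have Y: "above_roots h Y"
    unfolding Y_def using A by (intro above_roots_add assms(4))
  \<comment> \<open>Monotonicity carries the bound on the mean barrier from \<open>X\<close> to
    every \<open>Y + Z\<close>; by \<open>Re_mix\<close> the average there is at least
    \<open>h / \<delta>\<close>.\<close>
  have ge: "Re (h (Y + Z)) / \<delta> \<le> Re (mix S p h (Y + Z)) \<and> 0 < Re (h (Y + Z))" if "pos_semidef Z" for Z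
  proof -
    have "barrier h w (Y + Z) \<le> barrier h w X" for w
      using barrier_antimono[OF assms(4) pos_semidef_add[OF A that]] by (simp add: Y_def add.assoc)
    then have "(\<Sum>w\<in>S. p w * barrier h w (Y + Z)) \<le> (\<Sum>w\<in>S. p w * barrier h w X)"
      using assms(3) by (intro sum_mono mult_left_mono) (auto intro: less_imp_le)
    then have "1 / \<delta> \<le> 1 - (\<Sum>w\<in>S. p w * barrier h w (Y + Z))"
      using assms(6) by linarith
    moreover have pos: "0 < Re (h (Y + Z))"
      using Y that by (simp add: above_roots_def)
    ultimately show ?thesis
      using Re_mix[OF assms(2), of "Y + Z"] mult_left_mono[of "1 / \<delta>" _ "Re (h (Y + Z))"] by simp
  qed
  have pos: "0 < Re (mix S p h (Y + Z))" if "pos_semidef Z" for Z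
    using ge[OF that] divide_pos_pos[of "Re (h (Y + Z))" \<delta>] assms(5) by linarith
  then show "above_roots (mix S p h) Y"
    using Y by (simp add: above_roots_def)
  define a m g n where "a = Re (h Y)" and "m = Re (mix S p h Y)" and "g = Re (h (Y + self_outer u))"
    and "n = Re (mix S p h (Y + self_outer u))"
  have am: "a > 0" "m > 0" "a / \<delta> \<le> m"
    using ge[of 0] pos[of 0] by (auto simp: a_def m_def)
  define D where "D = (g * m - n * a) / a\<^sup>2"
  have D: "D \<le> 0" "g / a - 1 - \<delta> * D \<le> barrier h u X"
    using barrier_mix_le_tangent[OF assms(1-5), of u]
    by (simp_all add: D_def a_def m_def g_def n_def Y_def barrier_def)
  have "n / m = g / a - (a / m) * D"
    using am by (simp add: D_def field_simps power2_eq_square)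
  also have "\<dots> \<le> g / a - \<delta> * D"
  proof -
    have "a / m \<le> \<delta>" using am assms(5) by (simp add: field_simps)
    then have "\<delta> * D \<le> a / m * D" using D(1) by (rule mult_right_mono_neg)
    then show ?thesis by simp
  qed
  finally show "barrier (mix S p h) u Y \<le> barrier h u X"
    using D(2) by (simp add: barrier_def m_def n_def)
qed

end

section \<open>Independent sums\<close>

text \<open>A finitely supported distribution: its support and its weights.\<close>

type_synonym 'n dist = "(complex^'n) set \<times> (complex^'n \<Rightarrow> real)"

definition is_dist :: "'n::finite dist \<Rightarrow> bool" where
  "is_dist d \<longleftrightarrow> finite (fst d) \<and> (\<forall>w \<in> fst d. 0 < snd d w) \<and> sum (snd d) (fst d) = 1"

definition second_moment :: "'n::finite dist \<Rightarrow> complex^'n^'n" where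
  "second_moment d = (\<Sum>w\<in>fst d. snd d w *\<^sub>R self_outer w)"

text \<open>\<open>mixed [d\<^sub>1, \<dots>, d\<^sub>k] X\<close> is \<open>E det(X - \<Sum>i. w\<^sub>i w\<^sub>i\<^sup>*)\<close> for independent \<open>w\<^sub>i\<close> with distribution \<open>d\<^sub>i\<close>.\<close>

primrec mixed :: "'n::finite dist list \<Rightarrow> complex^'n^'n \<Rightarrow> complex" where
  "mixed [] = det"
| "mixed (d # ds) = mix (fst d) (snd d) (mixed ds)"

definition outer_sum :: "(complex^'n) list \<Rightarrow> complex^'n^'n" where
  "outer_sum ws = sum_list (map self_outer ws)"

lemma stable_form_mixed: "\<forall>d\<in>set ds. is_dist d \<Longrightarrow> stable_form (mixed ds)"
  by (induction ds) (auto simp: stable_form_det is_dist_def intro!: stable_form.stable_form_mix)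

text \<open>The vectors are fixed one by one and collected in \<open>W\<close>, while the ray beyond
  \<open>R\<close> stays the same.\<close>

lemma interlacing_mixed:
  assumes "\<forall>d\<in>set ds. is_dist d" "hermitian W"
    and "\<And>x. x \<ge> R \<Longrightarrow> 0 < Re (mixed ds (mat (of_real x) - W))"
  shows "\<exists>ws. list_all2 (\<lambda>w d. w \<in> fst d) ws ds \<and>
    (\<forall>x\<ge>R. 0 < Re (det (mat (of_real x) - (W + outer_sum ws))))"
  using assms
proof (induction ds arbitrary: W)
  case Nil
  then show ?case by (intro exI[of _ "[]"]) (simp add: outer_sum_def)
next
  case (Cons d ds)
  interpret stable_form "mixed ds"
    using Cons.prems(1) by (intro stable_form_mixed) auto
  have d: "is_dist d" using Cons.prems(1) by simp
  have "0 < Re (mix (fst d) (snd d) (mixed ds) (mat (of_real x) - W))" if "x \<ge> R" for x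
    using Cons.prems(3)[OF that] by simp
  then obtain w where w: "w \<in> fst d"
    "\<And>x. x \<ge> R \<Longrightarrow> 0 < Re (mixed ds (mat (of_real x) - (W + self_outer w)))"
    using interlacing[of "fst d" "snd d" W R] d Cons.prems(2) unfolding is_dist_def by blast
  obtain ws where "list_all2 (\<lambda>w d. w \<in> fst d) ws ds"
    "\<forall>x\<ge>R. 0 < Re (det (mat (of_real x) - (W + self_outer w + outer_sum ws)))"
    using Cons.IH[OF _ _ w(2)] Cons.prems(1,2) by auto
  with w(1) show ?case
    by (intro exI[of _ "w # ws"]) (simp add: outer_sum_def add.assoc)
qed

text \<open>All directions \<open>u\<close> are controlled at once because the next distribution
  tests its own directions. As no barrier grows, the condition imposed at \<open>X\<close> is still
  available at every step.\<close>

lemma barrier_mixed: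
  assumes "\<forall>d\<in>set ds. is_dist d" "above_roots det X" "\<delta> > 0"
    and "\<And>d. d \<in> set ds \<Longrightarrow> (\<Sum>w\<in>fst d. snd d w * barrier det w X) \<le> 1 - 1 / \<delta>"
  shows "above_roots (mixed ds) (X + \<delta> *\<^sub>R sum_list (map second_moment ds)) \<and>
    (\<forall>u. barrier (mixed ds) u (X + \<delta> *\<^sub>R sum_list (map second_moment ds)) \<le> barrier det u X)"
  using assms(1,4)
proof (induction ds)
  case Nil
  then show ?case using assms(2) by simp
next
  case (Cons d ds)
  interpret stable_form "mixed ds"
    using Cons.prems(1) by (intro stable_form_mixed) auto
  define Y where "Y = X + \<delta> *\<^sub>R sum_list (map second_moment ds)"
  have IH: "above_roots (mixed ds) Y" "\<And>u. barrier (mixed ds) u Y \<le> barrier det u X"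
    using Cons by (auto simp: Y_def)
  have d: "finite (fst d)" "sum (snd d) (fst d) = 1" "\<And>w. w \<in> fst d \<Longrightarrow> snd d w > 0"
    using Cons.prems(1) by (auto simp: is_dist_def)
  have "(\<Sum>w\<in>fst d. snd d w * barrier (mixed ds) w Y) \<le> (\<Sum>w\<in>fst d. snd d w * barrier det w X)"
    using IH(2) d(3) by (intro sum_mono mult_left_mono) (auto intro: less_imp_le)
  also have "\<dots> \<le> 1 - 1 / \<delta>" using Cons.prems(2) by simp
  finally have "(\<Sum>w\<in>fst d. snd d w * barrier (mixed ds) w Y) \<le> 1 - 1 / \<delta>" .
  note step = barrier_step[OF d IH(1) assms(3) this]
  have "X + \<delta> *\<^sub>R sum_list (map second_moment (d # ds)) =
      Y + \<delta> *\<^sub>R (\<Sum>w\<in>fst d. snd d w *\<^sub>R self_outer w)"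
    by (simp add: Y_def second_moment_def scaleR_add_right algebra_simps)
  then show ?case
    using step IH(2) by (auto intro: order_trans)
qed

section \<open>The starting point and the constants\<close>

lemma mat_of_real_add: "mat (of_real (a + b)) = mat (of_real a) + (mat (of_real b) :: complex^'n^'n)"
  by (simp add: vec_eq_iff mat_def)

lemma mat_eq_cscale: "mat c = c *\<^sub>C mat 1"
  by (simp add: vec_eq_iff mat_def)

lemma above_roots_det_pos_def: "pos_def X \<Longrightarrow> above_roots det X"
  by (auto simp: above_roots_def intro!: det_pos_def)

lemma Re_mult_of_real: "Re (z * of_real r) = Re z * r"
  by simp

lemma barrier_det_mat:
  assumes "t > 0"
  shows "barrier det u (mat (of_real t)) = (norm u)\<^sup>2 / t"
proof -
  have "mat (of_real t) + self_outer u = mat (of_real t) ** (mat 1 + of_real (1 / t) *\<^sub>C self_outer u)"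
    unfolding mat_eq_cscale[of "of_real t"] matrix_mult_cscale matrix_mul_lid
    using assms by (simp add: cscale_add_right cscale_cscale)
  then have "det (mat (of_real t) + self_outer u) =
      det (mat (of_real t) :: complex^'a^'a) * of_real (1 + (norm u)\<^sup>2 / t)"
    by (simp add: det_mul det_mat_1_rank_one)
  then have "Re (det (mat (of_real t) + self_outer u)) =
      Re (det (mat (of_real t) :: complex^'a^'a)) * (1 + (norm u)\<^sup>2 / t)"
    by (simp only: Re_mult_of_real)
  moreover have "Re (det (mat (of_real t) :: complex^'a^'a)) > 0"
    using assms by (intro det_pos_def pos_def_mat)
  ultimately show ?thesis by (simp add: barrier_def)
qed

lemma exists_outer_sum_pos:
  fixes ds :: "'n::finite dist list"
  assumes ds: "\<forall>d\<in>set ds. is_dist d"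
    and psd: "pos_semidef (mat 1 - sum_list (map second_moment ds))"
    and eps: "\<epsilon> > 0" "\<And>d. d \<in> set ds \<Longrightarrow> (\<Sum>w\<in>fst d. snd d w * (norm w)\<^sup>2) \<le> \<epsilon>"
  shows "\<exists>ws. list_all2 (\<lambda>w d. w \<in> fst d) ws ds \<and>
    (\<forall>x\<ge>(1 + sqrt \<epsilon>)\<^sup>2. 0 < Re (det (mat (of_real x) - outer_sum ws)))"
proof -
  define t \<delta> where "t = sqrt \<epsilon> + \<epsilon>" and "\<delta> = 1 + sqrt \<epsilon>"
  have pos: "t > 0" "\<delta> > 0" using eps(1) by (auto simp: t_def \<delta>_def add_pos_pos)
  have t: "t = sqrt \<epsilon> * \<delta>" and sum: "t + \<delta> = (1 + sqrt \<epsilon>)\<^sup>2"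
    using eps(1) by (simp_all add: t_def \<delta>_def power2_eq_square algebra_simps)
  have ratio: "\<epsilon> / t = 1 - 1 / \<delta>"
  proof -
    have "\<epsilon> = sqrt \<epsilon> * sqrt \<epsilon>" using eps(1) by simp
    then have "\<epsilon> / t = sqrt \<epsilon> / \<delta>"
      using eps(1) pos unfolding t by (metis less_irrefl mult_divide_mult_cancel_left real_sqrt_eq_zero_cancel_iff)
    also have "\<dots> = 1 - 1 / \<delta>" using pos by (simp add: \<delta>_def field_simps)
    finally show ?thesis .
  qed
  \<comment> \<open>The slack in the second moments goes into the start, so that the shifts end
    exactly at \<open>(t + \<delta>) I\<close>. Being semidefinite, it increases no barrier.\<close>
  define Z where "Z = \<delta> *\<^sub>R (mat 1 - sum_list (map second_moment ds))"
  have Z: "pos_semidef Z" unfolding Z_def using psd pos by (intro pos_semidef_scaleR) auto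
  define X where "X = mat (of_real t) + Z"
  have "above_roots det (mat (of_real t) :: complex^'n^'n)"
    using pos by (intro above_roots_det_pos_def pos_def_mat)
  then have X: "above_roots det X" "barrier det u X \<le> (norm u)\<^sup>2 / t" for u
    using Z pos stable_form.barrier_antimono[OF stable_form_det, of "mat (of_real t)" Z u]
    by (auto simp: X_def above_roots_add barrier_det_mat)
  have "(\<Sum>w\<in>fst d. snd d w * barrier det w X) \<le> 1 - 1 / \<delta>" if "d \<in> set ds" for d
  proof -
    have "(\<Sum>w\<in>fst d. snd d w * barrier det w X) \<le> (\<Sum>w\<in>fst d. snd d w * ((norm w)\<^sup>2 / t))"
      using ds that X(2) by (intro sum_mono mult_left_mono) (auto simp: is_dist_def intro: less_imp_le)
    also have "\<dots> = (\<Sum>w\<in>fst d. snd d w * (norm w)\<^sup>2) / t"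
      by (simp add: sum_divide_distrib)
    also have "\<dots> \<le> \<epsilon> / t"
      using eps(2)[OF that] pos by (simp add: divide_right_mono)
    finally show ?thesis by (simp add: ratio)
  qed
  then have "above_roots (mixed ds) (X + \<delta> *\<^sub>R sum_list (map second_moment ds))"
    using barrier_mixed[OF ds X(1) pos(2)] by blast
  also have "X + \<delta> *\<^sub>R sum_list (map second_moment ds) = mat (of_real t) + \<delta> *\<^sub>R mat 1"
    by (simp add: X_def Z_def scaleR_diff_right)
  also have "\<dots> = mat (of_real (t + \<delta>))"
    unfolding mat_of_real_add mat_eq_cscale[of "of_real \<delta>"] cscale_of_real ..
  finally have above: "above_roots (mixed ds) (mat (of_real (t + \<delta>)))" .
  have "0 < Re (mixed ds (mat (of_real x) - 0))" if "x \<ge> (1 + sqrt \<epsilon>)\<^sup>2" for x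
  proof -
    have "mat (of_real x) = mat (of_real (t + \<delta>)) + (mat (of_real (x - (t + \<delta>))) :: complex^'n^'n)"
      unfolding mat_of_real_add[symmetric] by simp
    moreover have "pos_semidef (mat (of_real (x - (t + \<delta>))) :: complex^'n^'n)"
      using that sum by (intro pos_semidef_mat) simp
    ultimately show ?thesis
      using above by (simp add: above_roots_def)
  qed
  from interlacing_mixed[OF ds hermitian_0 this] show ?thesis by simp
qed

section \<open>From positive determinants to the spectral norm\<close>

lemma spectral_norm_le_iff:
  assumes "L \<ge> 0"
  shows "spectral_norm (A :: complex^'n^'n) \<le> L \<longleftrightarrow> (\<forall>x. norm (A *v x) \<le> L * norm x)"
proof
  assume "spectral_norm A \<le> L"
  have "norm (A *v x) \<le> spectral_norm A * norm x" for x
    unfolding spectral_norm_def by (rule onorm[OF matrix_vector_mul_bounded_linear])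
  then show "\<forall>x. norm (A *v x) \<le> L * norm x"
    using \<open>spectral_norm A \<le> L\<close> by (meson mult_right_mono norm_ge_zero order_trans)
qed (auto simp: spectral_norm_def intro: onorm_le)

text \<open>The maximum \<open>l\<close> of the form on the unit sphere is an eigenvalue: the form
  of \<open>l I - N\<close> is nonnegative and vanishes at the maximiser. So the determinant is 0 at
  \<open>l\<close>, which forces \<open>l < R\<close>. Cauchy-Schwarz turns this bound on the form
  into one on the norm.\<close>

lemma spectral_norm_le_if_det_pos:
  fixes N :: "complex^'n^'n"
  assumes N: "pos_semidef N" and R: "R \<ge> 0"
    and pos: "\<And>x. x \<ge> R \<Longrightarrow> 0 < Re (det (mat (of_real x) - N))"
  shows "spectral_norm N \<le> R"
proof -
  have lin: "linear (\<lambda>x. N *v x)"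
    by (rule bounded_linear.linear[OF matrix_vector_mul_bounded_linear])
  have "continuous_on (sphere 0 1) (\<lambda>x. x \<bullet> (N *v x))"
    by (intro continuous_intros linear_continuous_on matrix_vector_mul_bounded_linear)
  moreover have "sphere (0 :: complex^'n) 1 \<noteq> {}" by simp
  ultimately obtain x0 where x0: "norm x0 = 1" "\<And>y. norm y = 1 \<Longrightarrow> y \<bullet> (N *v y) \<le> x0 \<bullet> (N *v x0)"
    using continuous_attains_sup[of "sphere 0 1" "\<lambda>x. x \<bullet> (N *v x)"] by auto
  define l where "l = x0 \<bullet> (N *v x0)"
  have le: "y \<bullet> (N *v y) \<le> l * (norm y)\<^sup>2" for y
  proof (cases "y = 0")
    case False
    define z where "z = (1 / norm y) *\<^sub>R y"
    have y: "y = norm y *\<^sub>R z" and "norm z = 1" using False by (auto simp: z_def)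
    have "y \<bullet> (N *v y) = (norm y)\<^sup>2 * (z \<bullet> (N *v z))"
      by (subst (1 2) y) (simp only: linear_scale[OF lin] inner_scaleR_left inner_scaleR_right power2_eq_square mult.assoc)
    also have "\<dots> \<le> (norm y)\<^sup>2 * l"
      unfolding l_def using x0(2)[OF \<open>norm z = 1\<close>] by (intro mult_left_mono) auto
    finally show ?thesis by (simp add: mult.commute)
  qed simp
  have q: "Re (cinner y ((mat (of_real l) - N) *v y)) = l * (norm y)\<^sup>2 - y \<bullet> (N *v y)" for y
    by (simp add: matrix_vector_mult_diff_rdistrib cinner_diff_right mat_mult_vec cinner_scale_right
        cinner_same Re_cinner_eq_inner del: of_real_power)
  have "pos_semidef (mat (of_real l) - N)"
    using N le by (auto simp: pos_semidef_iff q)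
  moreover have "Re (cinner x0 ((mat (of_real l) - N) *v x0)) = 0"
    by (simp only: q x0(1)) (simp add: l_def)
  ultimately have "(mat (of_real l) - N) *v x0 = 0"
    by (rule pos_semidef_null)
  then have "det (mat (of_real l) - N) = 0"
    using x0(1) by (intro det_zero_if_ker) auto
  then have "l < R" using pos[of l] by force
  have form: "Re (cinner y (N *v y)) \<le> R * (norm y)\<^sup>2" for y
    using le[of y] mult_right_mono[of l R "(norm y)\<^sup>2"] \<open>l < R\<close> by (simp add: Re_cinner_eq_inner)
  have "norm (N *v y) \<le> R * norm y" for y
  proof (cases "N *v y = 0")
    case False
    let ?n = "norm (N *v y)"
    have "?n ^ 4 \<le> Re (cinner y (N *v y)) * Re (cinner (N *v y) (N *v (N *v y)))"
      by (rule pos_semidef_cauchy_schwarz[OF N])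
    also have "\<dots> \<le> (R * (norm y)\<^sup>2) * (R * ?n\<^sup>2)"
      using N R by (intro mult_mono form) (auto simp: pos_semidef_iff)
    finally have "?n ^ 4 \<le> (R * (norm y)\<^sup>2) * (R * ?n\<^sup>2)" .
    then have "?n\<^sup>2 * ?n\<^sup>2 \<le> (R * norm y)\<^sup>2 * ?n\<^sup>2"
      by (simp add: power_mult_distrib power2_eq_square power4_eq_xxxx mult_ac)
    then have "?n\<^sup>2 \<le> (R * norm y)\<^sup>2"
      by (rule mult_right_le_imp_le) (use False in simp)
    then show ?thesis using R by (simp add: power2_le_iff_abs_le)
  qed (use R in simp)
  then show ?thesis using spectral_norm_le_iff[OF R] by blast
qed

lemma pos_semidef_outer_sum: "pos_semidef (outer_sum ws)"
  by (induction ws) (auto simp: outer_sum_def)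

lemma exists_outer_sum_spectral_norm_le:
  fixes ds :: "'n::finite dist list"
  assumes ds: "\<forall>d\<in>set ds. is_dist d"
    and psd: "pos_semidef (mat 1 - sum_list (map second_moment ds))"
    and eps: "\<epsilon> \<ge> 0" "\<And>d. d \<in> set ds \<Longrightarrow> (\<Sum>w\<in>fst d. snd d w * (norm w)\<^sup>2) \<le> \<epsilon>"
  shows "\<exists>ws. list_all2 (\<lambda>w d. w \<in> fst d) ws ds \<and> spectral_norm (outer_sum ws) \<le> (1 + sqrt \<epsilon>)\<^sup>2"
proof (rule ccontr)
  define F where "F = {ws. list_all2 (\<lambda>w d. w \<in> fst d) ws ds}"
  have ex: "\<exists>ws\<in>F. spectral_norm (outer_sum ws) \<le> (1 + sqrt (\<epsilon> + \<kappa>))\<^sup>2" if "\<kappa> > 0" for \<kappa>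
  proof -
    have "\<epsilon> + \<kappa> > 0" using eps(1) that by simp
    from exists_outer_sum_pos[OF ds psd this] eps(2) that obtain ws where "ws \<in> F"
      "\<forall>x\<ge>(1 + sqrt (\<epsilon> + \<kappa>))\<^sup>2. 0 < Re (det (mat (of_real x) - outer_sum ws))"
      unfolding F_def by fastforce
    then show ?thesis
      by (intro bexI[of _ ws] spectral_norm_le_if_det_pos pos_semidef_outer_sum) auto
  qed
  then have "F \<noteq> {}" using zero_less_one by blast
  have "F \<subseteq> {ws. set ws \<subseteq> (\<Union>d\<in>set ds. fst d) \<and> length ws = length ds}"
  proof
    fix ws assume "ws \<in> F"
    then have ws: "list_all2 (\<lambda>w d. w \<in> fst d) ws ds" by (simp add: F_def)
    then have len: "length ws = length ds" by (rule list_all2_lengthD)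
    have "ws ! i \<in> (\<Union>d\<in>set ds. fst d)" if "i < length ws" for i
      using list_all2_nthD[OF ws that] that len by (metis UN_I nth_mem)
    then have "set ws \<subseteq> (\<Union>d\<in>set ds. fst d)" by (metis in_set_conv_nth subsetI)
    with len show "ws \<in> {ws. set ws \<subseteq> (\<Union>d\<in>set ds. fst d) \<and> length ws = length ds}" by blast
  qed
  moreover have "finite (\<Union>d\<in>set ds. fst d)"
    using ds by (auto simp: is_dist_def)
  ultimately have "finite F"
    using finite_lists_length_eq finite_subset by blast
  \<comment> \<open>The choice supplied by \<open>ex\<close> depends on \<open>\<kappa>\<close>; the
    minimum over the finite set \<open>F\<close> does not, so the limit can be taken.\<close>
  define \<mu> where "\<mu> = Min ((\<lambda>ws. spectral_norm (outer_sum ws)) ` F)"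
  assume "\<nexists>ws. list_all2 (\<lambda>w d. w \<in> fst d) ws ds \<and> spectral_norm (outer_sum ws) \<le> (1 + sqrt \<epsilon>)\<^sup>2"
  then have gt: "\<mu> > (1 + sqrt \<epsilon>)\<^sup>2"
    using \<open>F \<noteq> {}\<close> \<open>finite F\<close> by (auto simp: \<mu>_def F_def not_le)
  have lim: "((\<lambda>\<kappa>. (1 + sqrt (\<epsilon> + \<kappa>))\<^sup>2) \<longlongrightarrow> (1 + sqrt \<epsilon>)\<^sup>2) (at_right 0)"
    by (auto intro!: tendsto_eq_intros)
  have "\<mu> \<le> (1 + sqrt (\<epsilon> + \<kappa>))\<^sup>2" if "\<kappa> > 0" for \<kappa>
    using ex[OF that] \<open>finite F\<close> unfolding \<mu>_def by (meson Min_le finite_imageI image_eqI order_trans)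
  then have "\<forall>\<^sub>F \<kappa> in at_right 0. \<mu> \<le> (1 + sqrt (\<epsilon> + \<kappa>))\<^sup>2"
    by (auto simp: eventually_at_filter)
  with lim have "\<mu> \<le> (1 + sqrt \<epsilon>)\<^sup>2"
    by (rule tendsto_lowerbound) simp
  with gt show False by simp
qed

section \<open>From random vectors to weighted supports and back\<close>

lemma (in prob_space) integral_finite_range:
  fixes V :: "'a \<Rightarrow> 'b :: {t1_space}" and g :: "'b \<Rightarrow> 'c :: {banach, second_countable_topology}"
  assumes "V \<in> borel_measurable M" "finite (V ` space M)"
  shows "has_bochner_integral M (\<lambda>\<omega>. g (V \<omega>))
    (\<Sum>w\<in>V ` space M. prob {\<omega> \<in> space M. V \<omega> = w} *\<^sub>R g w)"
proof -
  have "V -` {w} \<inter> space M \<in> sets M" for w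
    using assms(1) by (rule measurable_sets) simp
  moreover have "V -` {w} \<inter> space M = {\<omega> \<in> space M. V \<omega> = w}" for w by auto
  ultimately have sets: "{\<omega> \<in> space M. V \<omega> = w} \<in> sets M" for w by metis
  \<comment> \<open>\<open>g (V \<omega>)\<close> is a finite sum of constants on the measurable
    level sets of \<open>V\<close>.\<close>
  have "has_bochner_integral M (\<lambda>\<omega>. \<Sum>w\<in>V ` space M. indicator {\<omega> \<in> space M. V \<omega> = w} \<omega> *\<^sub>R g w)
      (\<Sum>w\<in>V ` space M. prob {\<omega> \<in> space M. V \<omega> = w} *\<^sub>R g w)"
    using sets by (intro has_bochner_integral_sum has_bochner_integral_scaleR_left
        has_bochner_integral_real_indicator) (auto simp: emeasure_finite less_top[symmetric])
  then show ?thesis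
  proof (rule has_bochner_integral_cong[THEN iffD1, rotated 3])
    fix \<omega> assume \<omega>: "\<omega> \<in> space M"
    have "(\<Sum>w\<in>V ` space M. indicator {\<omega> \<in> space M. V \<omega> = w} \<omega> *\<^sub>R g w) =
        (\<Sum>w\<in>V ` space M. if w = V \<omega> then g w else 0)"
      using \<omega> by (intro sum.cong) auto
    then show "(\<Sum>w\<in>V ` space M. indicator {\<omega> \<in> space M. V \<omega> = w} \<omega> *\<^sub>R g w) = g (V \<omega>)"
      using \<omega> assms(2) by simp
  qed auto
qed

text \<open>For each \<open>x\<close> the condition on \<open>A\<close> is closed, and the set is
  their intersection. This makes the event of the theorem measurable.\<close>

lemma closed_spectral_norm_le:
  assumes "L \<ge> 0"
  shows "closed {A :: complex^'n^'n. spectral_norm A \<le> L}"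
proof -
  have "closed {A :: complex^'n^'n. norm (A *v x) \<le> L * norm x}" for x
  proof (intro closed_Collect_le continuous_on_norm continuous_on_const linear_continuous_on)
    have "linear (\<lambda>A :: complex^'n^'n. A *v x)"
    proof
      fix r :: real and A :: "complex^'n^'n"
      show "(r *\<^sub>R A) *v x = r *\<^sub>R (A *v x)"
        by (simp add: scaleR_mult_vec vec_eq_iff) (simp add: scaleR_conv_of_real)
    qed (rule matrix_vector_mult_add_rdistrib)
    then show "bounded_linear (\<lambda>A :: complex^'n^'n. A *v x)"
      by (simp add: linear_conv_bounded_linear)
  qed
  then have "closed (\<Inter>x. {A :: complex^'n^'n. norm (A *v x) \<le> L * norm x})"
    by (intro closed_INT) blast
  moreover have "{A :: complex^'n^'n. spectral_norm A \<le> L} = (\<Inter>x. {A. norm (A *v x) \<le> L * norm x})"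
    by (auto simp: spectral_norm_le_iff[OF assms])
  ultimately show ?thesis by simp
qed

lemma measurable_self_outer [measurable]: "self_outer \<in> borel_measurable borel"
  unfolding self_outer_def[abs_def]
  by (intro borel_measurable_continuous_onI continuous_on_vec_lambda continuous_intros)

theorem theorem1:
  fixes M :: "'a measure"
    and v :: "nat \<Rightarrow> 'a \<Rightarrow> complex^'d"
    and m :: nat
    and \<epsilon> :: real
  assumes "prob_space M"
    and "m \<ge> 1"
    and "\<epsilon> \<ge> 0"
    and "prob_space.indep_vars M (\<lambda>_. borel) v {1..m}"
    and "\<And>i. i \<in> {1..m} \<Longrightarrow> finite (v i ` space M)"
    and "loewner_le (\<integral>\<omega>. (\<Sum>i=1..m. self_outer (v i \<omega>)) \<partial>M) (mat 1)"
    and "\<And>i. i \<in> {1..m} \<Longrightarrow> (\<integral>\<omega>. (norm (v i \<omega>))\<^sup>2 \<partial>M) \<le> \<epsilon>"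
  shows "measure M {\<omega> \<in> space M.
           spectral_norm (\<Sum>i=1..m. self_outer (v i \<omega>)) \<le> (1 + sqrt \<epsilon>)\<^sup>2} > 0"
proof -
  interpret prob_space M by fact
  have meas: "v i \<in> borel_measurable M" if "i \<in> {1..m}" for i
    using assms(4) that by (auto simp: indep_vars_def)
  define p where "p i w = prob {\<omega> \<in> space M. v i \<omega> = w}" for i w
  \<comment> \<open>Values of probability 0 are dropped, so that any choice from the supports has
    positive probability.\<close>
  define S where "S i = {w \<in> v i ` space M. 0 < p i w}" for i
  have expect: "has_bochner_integral M (\<lambda>\<omega>. g (v i \<omega>)) (\<Sum>w\<in>S i. p i w *\<^sub>R g w)" if "i \<in> {1..m}"
    for i and g :: "complex^'d \<Rightarrow> 'c :: {banach, second_countable_topology}"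
  proof -
    have "(\<Sum>w\<in>v i ` space M. p i w *\<^sub>R g w) = (\<Sum>w\<in>S i. p i w *\<^sub>R g w)"
      using assms(5)[OF that] by (intro sum.mono_neutral_right)
        (auto simp: S_def p_def zero_less_measure_iff)
    then show ?thesis
      using integral_finite_range[OF meas[OF that] assms(5)[OF that], of g] by (simp add: p_def)
  qed
  define ds where "ds = map (\<lambda>i. (S i, p i)) [1..<Suc m]"
  have dist: "\<forall>d\<in>set ds. is_dist d"
  proof -
    have "is_dist (S i, p i)" if "i \<in> {1..m}" for i
    proof -
      have "has_bochner_integral M (\<lambda>\<omega>. 1 :: real) (\<Sum>w\<in>S i. p i w *\<^sub>R 1)"
        using expect[OF that, of "\<lambda>_. 1 :: real"] .
      then have "(\<Sum>w\<in>S i. p i w) = 1"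
        by (simp add: has_bochner_integral_iff prob_space)
      then show ?thesis
        using assms(5)[OF that] by (simp add: is_dist_def S_def)
    qed
    then show ?thesis by (auto simp: ds_def)
  qed
  have "has_bochner_integral M (\<lambda>\<omega>. \<Sum>i=1..m. self_outer (v i \<omega>))
      (\<Sum>i=1..m. \<Sum>w\<in>S i. p i w *\<^sub>R self_outer w)"
    by (intro has_bochner_integral_sum expect)
  then have "(\<integral>\<omega>. (\<Sum>i=1..m. self_outer (v i \<omega>)) \<partial>M) = (\<Sum>i=1..m. second_moment (S i, p i))"
    by (simp add: has_bochner_integral_iff second_moment_def)
  also have "\<dots> = sum_list (map second_moment ds)"
    by (simp add: ds_def o_def sum_set_upt_conv_sum_list_nat[symmetric] atLeastLessThanSuc_atLeastAtMost
        del: upt_Suc)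
  finally have psd: "pos_semidef (mat 1 - sum_list (map second_moment ds))"
    using assms(6) by (simp add: loewner_le_def)
  have "(\<Sum>w\<in>fst d. snd d w * (norm w)\<^sup>2) \<le> \<epsilon>" if "d \<in> set ds" for d
  proof -
    have "d \<in> (\<lambda>i. (S i, p i)) ` {1..m}"
      using that by (simp add: ds_def atLeastLessThanSuc_atLeastAtMost del: upt_Suc)
    then obtain i where i: "i \<in> {1..m}" "d = (S i, p i)" by blast
    show ?thesis
      using expect[OF i(1), of "\<lambda>w. (norm w)\<^sup>2"] assms(7)[OF i(1)] i(2)
      by (simp add: has_bochner_integral_iff)
  qed
  then obtain ws where ws: "list_all2 (\<lambda>w d. w \<in> fst d) ws ds"
    "spectral_norm (outer_sum ws) \<le> (1 + sqrt \<epsilon>)\<^sup>2"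
    using exists_outer_sum_spectral_norm_le[OF dist psd assms(3)] by blast
  have len: "length ws = m"
    using list_all2_lengthD[OF ws(1)] by (simp add: ds_def)
  \<comment> \<open>List positions start at 0, the vectors at 1.\<close>
  define w where "w i = ws ! (i - 1)" for i
  have w: "w i \<in> S i" if "i \<in> {1..m}" for i
  proof -
    have "i - 1 < m" "Suc (i - 1) = i" using that by auto
    then show ?thesis
      using list_all2_nthD[OF ws(1), of "i - 1"] len by (simp add: w_def ds_def del: upt_Suc)
  qed
  have "(\<Sum>i=1..m. self_outer (w i)) = (\<Sum>i<m. self_outer (ws ! i))"
    by (simp add: sum.atLeast1_atMost_eq w_def)
  then have sum_w: "(\<Sum>i=1..m. self_outer (w i)) = outer_sum ws"
    by (simp add: outer_sum_def sum_list_sum_nth len atLeast0LessThan)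
  \<comment> \<open>The event that every \<open>v i\<close> takes its chosen value; independence
    makes its probability a product of positive weights.\<close>
  define E where "E = (\<Inter>i\<in>{1..m}. v i -` {w i} \<inter> space M)"
  have "prob E = (\<Prod>i\<in>{1..m}. prob (v i -` {w i} \<inter> space M))"
    unfolding E_def using assms(2) by (intro indep_varsD_finite[OF assms(4)]) auto
  moreover have "v i -` {w i} \<inter> space M = {\<omega> \<in> space M. v i \<omega> = w i}" for i by auto
  ultimately have "prob E = (\<Prod>i\<in>{1..m}. p i (w i))" by (simp add: p_def)
  also have "\<dots> > 0" using w by (intro prod_pos) (simp add: S_def)
  finally have "0 < prob E" .
  also have "prob E \<le> prob {\<omega> \<in> space M. spectral_norm (\<Sum>i=1..m. self_outer (v i \<omega>)) \<le> (1 + sqrt \<epsilon>)\<^sup>2}"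
  proof (rule finite_measure_mono)
    show "E \<subseteq> {\<omega> \<in> space M. spectral_norm (\<Sum>i=1..m. self_outer (v i \<omega>)) \<le> (1 + sqrt \<epsilon>)\<^sup>2}"
    proof
      fix \<omega> assume "\<omega> \<in> E"
      then have "\<omega> \<in> space M" "\<And>i. i \<in> {1..m} \<Longrightarrow> v i \<omega> = w i"
        using assms(2) by (auto simp: E_def)
      then show "\<omega> \<in> {\<omega> \<in> space M. spectral_norm (\<Sum>i=1..m. self_outer (v i \<omega>)) \<le> (1 + sqrt \<epsilon>)\<^sup>2}"
        using ws(2) sum_w by simp
    qed
    have "(\<lambda>\<omega>. \<Sum>i=1..m. self_outer (v i \<omega>)) \<in> borel_measurable M"
      using meas by (intro borel_measurable_sum measurable_compose[OF _ measurable_self_outer]) auto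
    then have "(\<lambda>\<omega>. \<Sum>i=1..m. self_outer (v i \<omega>)) -` {A. spectral_norm A \<le> (1 + sqrt \<epsilon>)\<^sup>2} \<inter> space M \<in> sets M"
      by (rule measurable_sets) (intro borel_closed closed_spectral_norm_le, simp)
    then show "{\<omega> \<in> space M. spectral_norm (\<Sum>i=1..m. self_outer (v i \<omega>)) \<le> (1 + sqrt \<epsilon>)\<^sup>2} \<in> sets M"
      by (simp add: vimage_def Int_def conj_commute)
  qed
  finally show ?thesis .
qed

end
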